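(* Let $L(s)=L(s,\mathcal A)$ be an $L$-function of degree $d$ satisfying the axioms described in the context, with pole of order $m$ at $s=1$ and conductor $\mathfrak C$. Then for every real $\sigma$ with $1\le \sigma\le 3$, $$(\sigma-1)^m L(\sigma)\ll \exp\left(C d\,\frac{\log \mathfrak C}{\log\log \mathfrak C}\right),$$ where $C>0$ and the implied constant depend only on $m$, and are absolute if $m\le d$. (For $\sigma=1$ the left side is interpreted as $\lim_{\sigma\to1^+}(\sigma-1)^mL(\sigma)$.)
   Context: Let $d\ge 1$. Let $\mathcal A=\{\mathcal A_p\}$ be a sequence, indexed by primes $p$, of $d\times d$ complex matrices with eigenvalues $\alpha_1(p),\dots,\alpha_d(p)$, and put $L(s,\mathcal A)=\prod_p\prod_{j=1}^d(1-\alpha_j(p)p^{-s})^{-1}=\sum_{n\ge1}a_n n^{-s}$, where the product and series converge absolutely for $\Re s>1$. Assume: (i) there is an integer $m=m(\mathcal A)\ge0$ such that $L(s,\mathcal A)$ continues analytically to all of $\mathbb C$ except possibly for a pole of order $m$ at $s=1$; (ii) there is $\delta>0$ such that for every $\epsilon>0$, $L(s,\mathcal A)\ll\exp\exp(\epsilon|t|)$ as $|t|\to\infty$, uniformly in $-\delta<\sigma<1+\delta$ (writing $s=\sigma+it$); (iii) there exist another sequence $\mathcal A^*$ of $d\times d$ matrices satisfying the Euler product condition and (i),(ii), a constant $Q=Q_{\mathcal A}$, complex numbers $\beta_1,\dots,\beta_d$ with $\Re\beta_i>-1/2$, and $\omega\in\mathbb C$ with $|\omega|=1$ such that $\Lambda(s,\mathcal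 A)=Q^{s/2}\prod_{i=1}^d\Gamma(s/2+\beta_i)L(s,\mathcal A)$ and $\Lambda(s,\mathcal A^* )=Q^{s/2}\prod_{i=1}^d\Gamma(s/2+\overline{\beta_i})L(s,\mathcal A^* )$ satisfy $\Lambda(1-s,\mathcal A)=\omega\Lambda(s,\mathcal A^* )$. The conductor is $\mathfrak C=(1+|Q|)\prod_{j=1}^d(3+|\beta_j|)$. *)

theory Defs
  imports "HOL-Complex_Analysis.Complex_Analysis" "Jordan_Normal_Form.Char_Poly"
begin

text \<open>
  A sequence of matrices indexed by the primes is a function on \<^typ>\<open>nat\<close> of which only the
  values at primes are used.  The eigenvalues, with algebraic multiplicity, are the elements of
  the multiset of roots of the characteristic polynomial; over the complex numbers there are
  exactly d of them for a d x d matrix.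
\<close>

definition eigenvalues_mset :: "complex mat \<Rightarrow> complex multiset" where
  "eigenvalues_mset M = proots (char_poly M)"

definition euler_factor :: "(nat \<Rightarrow> complex mat) \<Rightarrow> nat \<Rightarrow> complex \<Rightarrow> complex" where
  "euler_factor A p s =
     (\<Prod>\<alpha>\<in>#eigenvalues_mset (A p). inverse (1 - \<alpha> * of_nat p powr (- s)))"

text \<open>
  Infinite products are indexed by \<^typ>\<open>nat\<close> in the library, so the factors at
  non-primes are set to 1.  Absolute convergence refers to the product over p of the finite
  products over j.  Because \<^term>\<open>inverse 0 = 0\<close>, it is stated separately that no factor has a
  vanishing denominator.
\<close>

definition euler_product_condition ::
  "nat \<Rightarrow> (nat \<Rightarrow> complex mat) \<Rightarrow> (complex \<Rightarrow> complex) \<Rightarrow> bool" where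
  "euler_product_condition d A L \<longleftrightarrow>
     (\<forall>p. prime p \<longrightarrow> A p \<in> carrier_mat d d) \<and>
     (\<forall>s. Re s > 1 \<longrightarrow>
        (\<forall>p. prime p \<longrightarrow> (\<forall>\<alpha>\<in>#eigenvalues_mset (A p). 1 - \<alpha> * of_nat p powr (- s) \<noteq> 0)) \<and>
        abs_convergent_prod (\<lambda>p. if prime p then euler_factor A p s else 1) \<and>
        (\<lambda>p. if prime p then euler_factor A p s else 1) has_prod L s) \<and>
     (\<exists>a :: nat \<Rightarrow> complex. \<forall>s. Re s > 1 \<longrightarrow>
        (\<lambda>n. norm (a n * of_nat n powr (- s))) summable_on {1..} \<and>
        ((\<lambda>n. a n * of_nat n powr (- s)) has_sum L s) {1..})"

text \<open>
  The function L is the continuation itself.  For m = 0 it is entire; for m > 0 it has a pole of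
  order exactly m at 1, and its value at the point 1 is then irrelevant.
\<close>

definition continuation_condition :: "nat \<Rightarrow> (complex \<Rightarrow> complex) \<Rightarrow> bool" where
  "continuation_condition m L \<longleftrightarrow>
     L holomorphic_on (- {1}) \<and>
     (if m = 0 then L analytic_on {1} else is_pole L 1 \<and> zorder L 1 = - int m)"

definition growth_condition :: "(complex \<Rightarrow> complex) \<Rightarrow> bool" where
  "growth_condition L \<longleftrightarrow>
     (\<exists>\<delta>>0. \<forall>\<epsilon>>0. \<exists>K T. \<forall>s.
        - \<delta> < Re s \<and> Re s < 1 + \<delta> \<and> \<bar>Im s\<bar> \<ge> T \<longrightarrow>
        norm (L s) \<le> K * exp (exp (\<epsilon> * \<bar>Im s\<bar>)))"

text \<open>
  The constant Q is an arbitrary nonzero complex number and the power is taken with the principal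
  logarithm, which is the usual power for Q > 0.
\<close>

definition completed_L ::
  "nat \<Rightarrow> complex \<Rightarrow> (nat \<Rightarrow> complex) \<Rightarrow> (complex \<Rightarrow> complex) \<Rightarrow> complex \<Rightarrow> complex" where
  "completed_L d Q \<beta> L s = Q powr (s / 2) * (\<Prod>i=1..d. Gamma (s / 2 + \<beta> i)) * L s"

text \<open>
  The functional equation is an identity of meromorphic functions.  The library Gamma
  function takes the value 0 at its poles, so the pointwise identity is required away from the
  points where a Gamma factor or an L-function may have a pole.
\<close>

definition functional_equation ::
  "nat \<Rightarrow> complex \<Rightarrow> (nat \<Rightarrow> complex) \<Rightarrow> complex \<Rightarrow>
   (complex \<Rightarrow> complex) \<Rightarrow> (complex \<Rightarrow> complex) \<Rightarrow> bool" where
  "functional_equation d Q \<beta> \<omega> L L' \<longleftrightarrow>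
     (\<forall>s. s \<noteq> 0 \<and> s \<noteq> 1 \<and>
          (\<forall>i\<in>{1..d}. (1 - s) / 2 + \<beta> i \<notin> \<int>\<^sub>\<le>\<^sub>0 \<and> s / 2 + cnj (\<beta> i) \<notin> \<int>\<^sub>\<le>\<^sub>0) \<longrightarrow>
          completed_L d Q \<beta> L (1 - s) = \<omega> * completed_L d Q (\<lambda>i. cnj (\<beta> i)) L' s)"

definition L_function ::
  "nat \<Rightarrow> (nat \<Rightarrow> complex mat) \<Rightarrow> nat \<Rightarrow> complex \<Rightarrow> (nat \<Rightarrow> complex) \<Rightarrow>
   (complex \<Rightarrow> complex) \<Rightarrow> bool" where
  "L_function d A m Q \<beta> L \<longleftrightarrow>
     euler_product_condition d A L \<and> continuation_condition m L \<and> growth_condition L \<and>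
     Q \<noteq> 0 \<and> (\<forall>i\<in>{1..d}. Re (\<beta> i) > - 1 / 2) \<and>
     (\<exists>A' m' L' \<omega>.
        euler_product_condition d A' L' \<and> continuation_condition m' L' \<and> growth_condition L' \<and>
        norm \<omega> = 1 \<and> functional_equation d Q \<beta> \<omega> L L')"

definition conductor :: "nat \<Rightarrow> complex \<Rightarrow> (nat \<Rightarrow> complex) \<Rightarrow> real" where
  "conductor d Q \<beta> = (1 + norm Q) * (\<Prod>j=1..d. 3 + norm (\<beta> j))"

text \<open>The endpoint 1 stands for the limit from the right, whose existence is part of the claim.\<close>

definition edge_bound :: "nat \<Rightarrow> (complex \<Rightarrow> complex) \<Rightarrow> real \<Rightarrow> bool" where
  "edge_bound m L B \<longleftrightarrow>
     (\<forall>\<sigma>::real. 1 < \<sigma> \<and> \<sigma> \<le> 3 \<longrightarrow>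
        norm (of_real (\<sigma> - 1) ^ m * L (of_real \<sigma>)) \<le> B) \<and>
     (\<exists>l. ((\<lambda>\<sigma>::real. of_real (\<sigma> - 1) ^ m * L (of_real \<sigma>)) \<longlongrightarrow> l) (at_right 1) \<and> norm l \<le> B)"

end

theory Submission
  imports Defs "HOL-Real_Asymp.Real_Asymp"
begin

text \<open>
  Write \<open>\<ell>\<close> for the logarithm of the conductor, \<open>\<Delta> = O(1) + (ln \<ell>) / 2\<close>, \<open>x = exp \<Delta>\<close>,
  \<open>w = 168 / \<Delta>\<close> and \<open>H = d \<Delta> x + \<ell> / \<Delta>\<close>, which is \<open>O(d \<ell> / ln \<ell>)\<close>. Let \<open>k\<close> be the least
  constant such that \<open>L\<close> and the dual function \<open>L'\<close> are at most \<open>exp (k (H + d \<bar>t\<bar>))\<close> in absolute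
  value for \<open>Re s \<ge> 1 + w\<close>; it is finite because the Dirichlet series converge absolutely there.

  The eigenvalues at \<open>p\<close> have modulus at most \<open>p\<close>, so the Euler factors with \<open>p \<le> x\<close> contribute at
  most \<open>exp H\<close>, and the logarithm \<open>f\<close> of the product of the others is at most \<open>1 / x\<close> once
  \<open>Re s > 7\<close>. A Schwarz lemma for \<open>f\<close>, whose real part is bounded above, improves \<open>k\<close> to
  \<open>k / 2 + O(1)\<close> on \<open>Re s \<ge> 1 + 2 w\<close>. The functional equation carries this bound to
  \<open>Re s = - 1 / 2\<close> with an additional \<open>O(\<ell>)\<close> in the exponent, and interpolating between the two lines
  costs only \<open>O(w \<ell>) = O(H)\<close> for \<open>1 \<le> Re s \<le> 1 + 2 w\<close>. Hence \<open>k \<le> 5 k / 8 + O(1)\<close>, that is,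
  \<open>k = O(1)\<close>. The functional equation forces the poles to have order at most \<open>d\<close>, so that removing
  them costs only \<open>O(d \<Delta>)\<close> in the exponent.
\<close>

section \<open>Maximum principles\<close>

lemma maximum_modulus_cbox:
  fixes f :: "complex \<Rightarrow> complex"
  assumes "f holomorphic_on box a b" "continuous_on (cbox a b) f" "\<xi> \<in> cbox a b"
    and "\<And>z. z \<in> cbox a b - box a b \<Longrightarrow> norm (f z) \<le> B"
  shows "norm (f \<xi>) \<le> B"
  by (rule maximum_modulus_frontier[of f "cbox a b"])
    (use assms in \<open>auto simp: interior_cbox frontier_cbox\<close>)

text \<open>Multiply F by \<open>exp (- \<eta> * cos (s - c))\<close> with c the midpoint of the
  strip. Half the width is at most 1, so \<open>cos (Re s - Re c) \<ge> cos 1 > 0\<close> and the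
  factor decays doubly exponentially with rate \<open>exp \<bar>Im s\<bar>\<close>, which beats the
  assumed \<open>exp (\<bar>Im s\<bar> / 2)\<close>. Apply the maximum principle on a tall
  rectangle, then let \<eta> tend to 0.\<close>

lemma phragmen_lindelof_strip:
  fixes F :: "complex \<Rightarrow> complex"
  assumes ab: "a < b" "b - a \<le> 2" and "R > 0"
    and hol: "F holomorphic_on {s. a < Re s \<and> Re s < b}"
    and cont: "continuous_on {s. a \<le> Re s \<and> Re s \<le> b} F"
    and growth: "\<And>s. a \<le> Re s \<Longrightarrow> Re s \<le> b \<Longrightarrow> \<bar>Im s\<bar> \<ge> T \<Longrightarrow>
                   norm (F s) \<le> K * exp (exp (\<bar>Im s\<bar> / 2))"
    and edges: "\<And>s. Re s = a \<or> Re s = b \<Longrightarrow> norm (F s) \<le> R"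
    and s0: "a \<le> Re s0" "Re s0 \<le> b"
  shows "norm (F s0) \<le> R"
proof -
  define c where "c = complex_of_real ((a + b) / 2)"
  define A where "A = cos (Re s0 - Re c) * cosh (Im s0)"
  have cos1: "cos (1::real) > 0"
    by (rule cos_gt_zero) (use pi_gt3 in auto)
  have cosx: "cos (Re s - Re c) \<ge> cos 1" if "a \<le> Re s" "Re s \<le> b" for s
  proof -
    have "\<bar>Re s - Re c\<bar> \<le> 1"
      using that ab by (simp add: c_def abs_le_iff field_simps)
    then have "cos \<bar>Re s - Re c\<bar> \<ge> cos 1"
      by (intro cos_monotone_0_pi_le) (use pi_gt3 in auto)
    then show ?thesis by simp
  qed
  have normexp: "norm (exp (- (of_real \<eta> * cos (s - c)))) =
      exp (- (\<eta> * (cos (Re s - Re c) * cosh (Im s))))" for \<eta> s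
    by (simp add: Re_cos c_def cosh_field_def)
  have main: "norm (F s0) * exp (- (\<eta> * A)) \<le> R" if "\<eta> > 0" for \<eta> :: real
  proof -
    define G where "G = (\<lambda>s. F s * exp (- (of_real \<eta> * cos (s - c))))"
    define e where "e = \<eta> * cos 1 / 2"
    have "e > 0" using \<open>\<eta> > 0\<close> cos1 by (simp add: e_def)
    have "((\<lambda>y. exp (exp (y/2) - e * exp y)) \<longlongrightarrow> 0) at_top"
      using \<open>e > 0\<close> by real_asymp
    then have "((\<lambda>y. \<bar>K\<bar> * exp (exp (y/2) - e * exp y)) \<longlongrightarrow> 0) at_top"
      by (rule tendsto_mult_right_zero)
    then have "eventually (\<lambda>y. \<bar>K\<bar> * exp (exp (y/2) - e * exp y) < R) at_top"
      using \<open>R > 0\<close> by (rule order_tendstoD)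
    then have "eventually (\<lambda>y. \<bar>K\<bar> * exp (exp (y/2) - e * exp y) < R \<and> y \<ge> T \<and> y \<ge> \<bar>Im s0\<bar> \<and> y > 0) at_top"
      by (intro eventually_conj eventually_ge_at_top eventually_gt_at_top)
    \<comment> \<open>Y is the half-height of the rectangle: it contains \<open>s0\<close>, and on
      its horizontal sides the damped function is already below R.\<close>
    then obtain Y where Y: "\<bar>K\<bar> * exp (exp (Y/2) - e * exp Y) < R" "Y \<ge> T" "Y \<ge> \<bar>Im s0\<bar>" "Y > 0"
      by (auto simp: eventually_at_top_linorder)
    have far: "norm (G s) \<le> R" if "a \<le> Re s" "Re s \<le> b" "\<bar>Im s\<bar> = Y" for s
    proof -
      have "cosh (Im s) \<ge> exp Y / 2"
        using that(3) by (cases "Im s \<ge> 0") (auto simp: cosh_field_def)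
      then have "cos (Re s - Re c) * cosh (Im s) \<ge> cos 1 * (exp Y / 2)"
        using cosx[OF that(1,2)] cos1 by (intro mult_mono) auto
      then have "\<eta> * (cos (Re s - Re c) * cosh (Im s)) \<ge> \<eta> * (cos 1 * (exp Y / 2))"
        using \<open>\<eta> > 0\<close> by (intro mult_left_mono) auto
      then have 1: "norm (exp (- (of_real \<eta> * cos (s - c)))) \<le> exp (- (e * exp Y))"
        unfolding normexp by (simp add: e_def mult_ac)
      have "norm (F s) \<le> K * exp (exp (\<bar>Im s\<bar> / 2))"
        by (rule growth) (use that Y in auto)
      also have "\<dots> \<le> \<bar>K\<bar> * exp (exp (Y / 2))"
        using that(3) by (intro mult_mono) auto
      finally have "norm (G s) \<le> \<bar>K\<bar> * exp (exp (Y / 2)) * exp (- (e * exp Y))"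
        unfolding G_def norm_mult using 1 by (intro mult_mono) auto
      also have "\<dots> = \<bar>K\<bar> * exp (exp (Y/2) - e * exp Y)"
        by (simp add: exp_diff exp_minus field_simps)
      finally show ?thesis using Y by simp
    qed
    have near: "norm (G s) \<le> R" if "Re s = a \<or> Re s = b" for s
    proof -
      have "cos (Re s - Re c) \<ge> 0"
        using cosx[of s] cos1 that ab by auto
      then have "norm (exp (- (of_real \<eta> * cos (s - c)))) \<le> 1"
        unfolding normexp using \<open>\<eta> > 0\<close> by auto
      then have "norm (G s) \<le> R * 1"
        unfolding G_def norm_mult using edges[OF that] \<open>R > 0\<close> by (intro mult_mono) auto
      then show ?thesis by simp
    qed
    have "norm (G s0) \<le> R"
    proof (rule maximum_modulus_cbox[where f = G and a = "Complex a (- Y)" and b = "Complex b Y"])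
      show "G holomorphic_on box (Complex a (- Y)) (Complex b Y)"
        unfolding G_def
        by (intro holomorphic_intros holomorphic_on_subset[OF hol])
          (auto simp: in_box_complex_iff)
      show "continuous_on (cbox (Complex a (- Y)) (Complex b Y)) G"
        unfolding G_def
        by (intro continuous_intros continuous_on_subset[OF cont])
          (auto simp: in_cbox_complex_iff)
      show "s0 \<in> cbox (Complex a (- Y)) (Complex b Y)"
        using s0 Y by (auto simp: in_cbox_complex_iff)
      show "norm (G z) \<le> R" if "z \<in> cbox (Complex a (- Y)) (Complex b Y) - box (Complex a (- Y)) (Complex b Y)" for z
        using that far[of z] near[of z] Y
        by (auto simp: in_cbox_complex_iff in_box_complex_iff)
    qed
    then show ?thesis
      unfolding G_def norm_mult normexp A_def .
  qed
  have "((\<lambda>\<eta>. norm (F s0) * exp (- (\<eta> * A))) \<longlongrightarrow> norm (F s0) * exp (- (0 * A))) (at_right 0)"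
    by (intro tendsto_intros)
  then have "norm (F s0) * exp (- (0 * A)) \<le> R"
    by (rule tendsto_upperbound) (use main in \<open>auto simp: eventually_at_right_less eventually_at_filter\<close>)
  then show ?thesis by simp
qed

text \<open>The Moebius image \<open>f / (2 S - f)\<close> is bounded by 1 on the rectangle and by \<open>exp (- \<Delta>)\<close> on its
  right edge. The real part of \<open>(z + z\<^sup>2) / 42\<close> is at most 1 on the right edge and at most 0 on the
  other three, so the maximum principle propagates the decay to the left.\<close>

lemma norm_le_quarter_of_Re_le:
  fixes f :: "complex \<Rightarrow> complex"
  assumes hol: "f holomorphic_on cbox (Complex 0 (-7)) (Complex 6 7)"
    and S: "S \<ge> 1" and \<Delta>: "\<Delta> \<ge> 0"
    and Re_le: "\<And>z. z \<in> cbox (Complex 0 (-7)) (Complex 6 7) \<Longrightarrow> Re (f z) \<le> S"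
    and right: "\<And>z. Re z = 6 \<Longrightarrow> norm (f z) \<le> exp (- \<Delta>)"
    and w: "0 \<le> w" "w \<le> 6" "168 \<le> \<Delta> * w"
  shows "norm (f (of_real w)) \<le> S / 4"
proof -
  let ?R = "cbox (Complex 0 (-7)) (Complex 6 7)"
  define \<phi> where "\<phi> = (\<lambda>z. f z / (2 * of_real S - f z))"
  define g where "g = (\<lambda>z. \<phi> z * exp (of_real \<Delta> * (z + z\<^sup>2) / 42))"
  have nz: "2 * of_real S - f z \<noteq> 0" if "z \<in> ?R" for z
  proof
    assume "2 * of_real S - f z = 0"
    then have "Re (f z) = 2 * S" by (simp add: complex_eq_iff)
    then show False using Re_le[OF that] S by simp
  qed
  \<comment> \<open>Since \<open>Re (f z) \<le> S\<close>, the value \<open>f z\<close> is no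
    farther from 0 than from \<open>2 * S\<close>: the squared distances differ by
    \<open>4 * S * (S - Re (f z))\<close>.\<close>
  have \<phi>1: "norm (\<phi> z) \<le> 1" if "z \<in> ?R" for z
  proof -
    have "norm (f z) ^ 2 \<le> norm (2 * of_real S - f z) ^ 2"
    proof -
      have "S * Re (f z) \<le> S * S" using Re_le[OF that] S by (intro mult_left_mono) auto
      then show ?thesis
        unfolding cmod_power2 by (simp add: power2_eq_square algebra_simps)
    qed
    then have "norm (f z) \<le> norm (2 * of_real S - f z)"
      by (rule power2_le_imp_le) auto
    then show ?thesis
      using nz[OF that] by (simp add: \<phi>_def norm_divide divide_le_eq_1)
  qed
  have normexp: "norm (exp (of_real \<Delta> * (z + z\<^sup>2) / 42)) = exp (\<Delta> * (Re z + (Re z)\<^sup>2 - (Im z)\<^sup>2) / 42)" for z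
    by (simp add: power2_eq_square algebra_simps)
  have holphi: "\<phi> holomorphic_on ?R"
    unfolding \<phi>_def by (intro holomorphic_intros hol) (use nz in auto)
  have holg: "g holomorphic_on ?R"
    unfolding g_def by (intro holomorphic_intros holphi) auto
  have "norm (g (of_real w)) \<le> 1"
  proof (rule maximum_modulus_cbox[where f = g and a = "Complex 0 (-7)" and b = "Complex 6 7"])
    show "g holomorphic_on box (Complex 0 (-7)) (Complex 6 7)"
      by (rule holomorphic_on_subset[OF holg box_subset_cbox])
    show "continuous_on ?R g" using holg by (rule holomorphic_on_imp_continuous_on)
    show "of_real w \<in> ?R" using w by (auto simp: in_cbox_complex_iff)
    fix z assume z: "z \<in> ?R - box (Complex 0 (-7)) (Complex 6 7)"
    then have zR: "z \<in> ?R" and x: "0 \<le> Re z" "Re z \<le> 6" by (auto simp: in_cbox_complex_iff)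
    \<comment> \<open>\<open>42 = 6 + 6\<^sup>2\<close> is attained on the right edge. On the
      horizontal sides \<open>(Im z)\<^sup>2 = 49\<close> exceeds it, so the exponent is not
      positive there.\<close>
    have xx: "Re z + (Re z)\<^sup>2 \<le> 42"
      using power_mono[of "Re z" 6 2] x by simp
    consider "Re z = 0" | "Re z = 6" | "\<bar>Im z\<bar> = 7"
      using z by (auto simp: in_cbox_complex_iff in_box_complex_iff)
    then show "norm (g z) \<le> 1"
    proof cases
      case 2
      have e1: "exp (- \<Delta>) \<le> 1" using \<Delta> by simp
      have "2 * S - norm (f z) \<le> norm (2 * of_real S - f z)"
        using norm_triangle_ineq2[of "2 * of_real S" "f z"] S by (simp add: norm_mult)
      then have "1 \<le> norm (2 * of_real S - f z)" using right[OF 2] e1 S by linarith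
      then have "norm (\<phi> z) \<le> exp (- \<Delta>) / 1"
        unfolding \<phi>_def norm_divide using right[OF 2] by (intro frac_le) auto
      moreover have "norm (exp (of_real \<Delta> * (z + z\<^sup>2) / 42)) \<le> exp \<Delta>"
        unfolding normexp using \<Delta> 2 by (simp add: algebra_simps mult_left_le)
      ultimately have "norm (g z) \<le> exp (- \<Delta>) * exp \<Delta>"
        unfolding g_def norm_mult by (intro mult_mono) auto
      then show ?thesis by (simp add: exp_minus)
    next
      case 1
      have "norm (exp (of_real \<Delta> * (z + z\<^sup>2) / 42)) \<le> 1"
        unfolding normexp using \<Delta> 1 by simp
      then show ?thesis unfolding g_def norm_mult using \<phi>1[OF zR] by (intro mult_le_one) auto
    next
      case 3
      then have "(Im z)\<^sup>2 = 49" by (metis power2_abs power2_eq_square mult_numeral_1 numeral_times_numeral semiring_norm)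
      then have "\<Delta> * (Re z + (Re z)\<^sup>2 - (Im z)\<^sup>2) \<le> 0"
        using xx \<Delta> by (intro mult_nonneg_nonpos) auto
      then have "norm (exp (of_real \<Delta> * (z + z\<^sup>2) / 42)) \<le> 1"
        unfolding normexp by simp
      then show ?thesis unfolding g_def norm_mult using \<phi>1[OF zR] by (intro mult_le_one) auto
    qed
  qed
  then have 1: "norm (\<phi> (of_real w)) * exp (\<Delta> * (w + w\<^sup>2) / 42) \<le> 1"
    unfolding g_def norm_mult normexp by simp
  \<comment> \<open>As \<open>168 = 4 * 42\<close>, the weight at w is at least
    \<open>exp 4 \<ge> 9\<close>, so \<open>norm (\<phi> w) \<le> 1 / 9\<close>. Hence
    \<open>9 * norm (f w) \<le> 2 * S + norm (f w)\<close>, which gives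
    \<open>S / 4\<close>.\<close>
  have "exp 1 ^ 4 = exp (4::real)" by (simp flip: exp_of_nat_mult)
  moreover have "(2::real) ^ 4 \<le> exp 1 ^ 4"
    using exp_ge_add_one_self[of 1] by (intro power_mono) auto
  ultimately have "9 \<le> exp (4::real)" by simp
  also have "(4::real) \<le> \<Delta> * (w + w\<^sup>2) / 42"
    using w \<Delta> by (simp add: distrib_left add_increasing2)
  then have "exp (4::real) \<le> exp (\<Delta> * (w + w\<^sup>2) / 42)" by simp
  finally have "norm (\<phi> (of_real w)) * 9 \<le> 1"
    using 1 mult_left_mono[of 9 "exp (\<Delta> * (w + w\<^sup>2) / 42)" "norm (\<phi> (of_real w))"] by simp
  moreover have wR: "of_real w \<in> ?R" using w by (auto simp: in_cbox_complex_iff)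
  ultimately have "9 * norm (f (of_real w)) \<le> norm (2 * of_real S - f (of_real w))"
    using nz[OF wR] by (simp add: \<phi>_def norm_divide field_simps)
  also have "\<dots> \<le> 2 * S + norm (f (of_real w))"
    using norm_triangle_ineq4[of "2 * of_real S" "f (of_real w)"] S by (simp add: norm_mult)
  finally show ?thesis by simp
qed

section \<open>Euler products\<close>

lemma norm_prod_mset_image:
  "norm (\<Prod>x\<in>#M. f x :: 'a :: real_normed_field) = (\<Prod>x\<in>#M. norm (f x))"
  by (induction M) (auto simp: norm_mult)

lemma prod_mset_image_le_power:
  fixes f :: "'b \<Rightarrow> real"
  assumes "\<And>x. x \<in># M \<Longrightarrow> 0 \<le> f x \<and> f x \<le> c"
  shows "0 \<le> (\<Prod>x\<in>#M. f x) \<and> (\<Prod>x\<in>#M. f x) \<le> c ^ size M"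
  using assms
proof (induction M)
  case (add x M)
  then have "0 \<le> f x" "f x \<le> c" "0 \<le> (\<Prod>x\<in>#M. f x)" "(\<Prod>x\<in>#M. f x) \<le> c ^ size M"
    by auto
  then show ?case by (auto intro!: mult_mono)
qed auto

lemma holomorphic_on_prod_mset:
  fixes f :: "'b \<Rightarrow> complex \<Rightarrow> complex"
  assumes "\<And>x. x \<in># M \<Longrightarrow> f x holomorphic_on S"
  shows "(\<lambda>s. \<Prod>x\<in>#M. f x s) holomorphic_on S"
  using assms by (induction M) (auto intro!: holomorphic_intros)

text \<open>Induction through \<open>x * y - 1 = (x - 1) * y + (y - 1)\<close>. Carrying the summand
  1 on the left makes the bounds multiply, each factor contributing
  \<open>1 + c \<le> exp c\<close>.\<close>

lemma norm_prod_mset_minus_1_le: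
  fixes f :: "'b \<Rightarrow> 'a :: real_normed_field"
  assumes "\<And>x. x \<in># M \<Longrightarrow> norm (f x - 1) \<le> c"
  shows "1 + norm ((\<Prod>x\<in>#M. f x) - 1) \<le> exp (c * size M)"
  using assms
proof (induction M)
  case (add x M)
  define P where "P = (\<Prod>x\<in>#M. f x)"
  have c: "norm (f x - 1) \<le> c"
    using add.prems[of x] by simp
  then have "0 \<le> c" by (rule order.trans[OF norm_ge_zero])
  have IH: "1 + norm (P - 1) \<le> exp (c * size M)"
    unfolding P_def using add by auto
  have "norm P \<le> 1 + norm (P - 1)"
    using norm_triangle_ineq[of 1 "P - 1"] by simp
  have "f x * P - 1 = (f x - 1) * P + (P - 1)"
    by (simp add: algebra_simps)
  then have "norm (f x * P - 1) \<le> norm (f x - 1) * norm P + norm (P - 1)"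
    by (metis norm_triangle_ineq norm_mult)
  also have "\<dots> \<le> c * (1 + norm (P - 1)) + norm (P - 1)"
    using c \<open>0 \<le> c\<close> \<open>norm P \<le> _\<close> by (intro add_mono mult_mono) auto
  finally have "1 + norm (f x * P - 1) \<le> (1 + c) * (1 + norm (P - 1))"
    by (simp add: algebra_simps)
  also have "\<dots> \<le> exp c * exp (c * size M)"
    using IH \<open>0 \<le> c\<close> exp_ge_add_one_self[of c] by (intro mult_mono) auto
  finally show ?case
    by (simp add: P_def exp_add algebra_simps)
qed auto

section \<open>Local factors to the right of the line Re s = 1\<close>

definition local_factor :: "(nat \<Rightarrow> complex mat) \<Rightarrow> complex \<Rightarrow> nat \<Rightarrow> complex" where
  "local_factor A s p = (if prime p then euler_factor A p s else 1)"

lemma size_eigenvalues_mset: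
  assumes "M \<in> carrier_mat d d"
  shows "size (eigenvalues_mset M) = d"
  using degree_monic_char_poly[OF assms] by (simp add: eigenvalues_mset_def size_proots_complex)

context
  fixes d :: nat and A :: "nat \<Rightarrow> complex mat" and L :: "complex \<Rightarrow> complex"
  assumes euler: "euler_product_condition d A L"
begin

lemma size_eigenvalues: "prime p \<Longrightarrow> size (eigenvalues_mset (A p)) = d"
  using euler by (auto simp: euler_product_condition_def intro!: size_eigenvalues_mset)

lemma denominator_nonzero:
  "prime p \<Longrightarrow> \<alpha> \<in># eigenvalues_mset (A p) \<Longrightarrow> Re s > 1 \<Longrightarrow> 1 - \<alpha> * of_nat p powr (- s) \<noteq> 0"
  using euler by (auto simp: euler_product_condition_def)

lemma has_prod_L: "Re s > 1 \<Longrightarrow> local_factor A s has_prod L s"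
  using euler by (auto simp: euler_product_condition_def local_factor_def[abs_def])

text \<open>For a larger eigenvalue, the denominator vanishes at some point with real part above 1.\<close>

lemma norm_eigenvalue_le:
  assumes p: "prime p" and \<alpha>: "\<alpha> \<in># eigenvalues_mset (A p)"
  shows "norm \<alpha> \<le> real p"
proof (rule ccontr)
  assume *: "\<not> norm \<alpha> \<le> real p"
  have p1: "real p > 1" using prime_gt_1_nat[OF p] by simp
  then have lnp: "ln (real p) > 0" by simp
  \<comment> \<open>This s solves \<open>\<alpha> * of_nat p powr (- s) = 1\<close>, and its real
    part is \<open>ln (norm \<alpha>) / ln p > 1\<close>.\<close>
  define s where "s = Ln \<alpha> / of_real (ln (real p))"
  have "\<alpha> \<noteq> 0" using * p1 by auto
  have "ln (real p) < ln (norm \<alpha>)"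
    by (subst ln_less_cancel_iff) (use * p1 in linarith)+
  then have "Re s > 1"
    using lnp \<open>\<alpha> \<noteq> 0\<close> by (simp add: s_def Re_divide_of_real)
  moreover have "1 - \<alpha> * of_nat p powr (- s) = 0"
  proof -
    have "(of_nat p :: complex) \<noteq> 0" using p1 by auto
    moreover have "Ln (of_nat p) = of_real (ln (real p))"
      using p1 Ln_of_real[of "real p"] by simp
    ultimately have "of_nat p powr (- s) = exp (- Ln \<alpha>)"
      using lnp by (simp add: powr_def s_def)
    then show ?thesis using \<open>\<alpha> \<noteq> 0\<close> by (simp add: exp_minus)
  qed
  ultimately show False using denominator_nonzero[OF p \<alpha>] by blast
qed

lemma norm_eigenvalue_powr_le:
  assumes p: "prime p" and \<alpha>: "\<alpha> \<in># eigenvalues_mset (A p)"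
  shows "norm (\<alpha> * of_nat p powr (- s)) \<le> real p powr (1 - Re s)"
proof -
  have p0: "real p > 0" using prime_gt_0_nat[OF p] by simp
  have "norm ((of_nat p :: complex) powr (- s)) = real p powr (- Re s)"
    using p0 norm_powr_real_powr[of "of_nat p" "-s"] by simp
  then have "norm (\<alpha> * of_nat p powr (- s)) \<le> real p * real p powr (- Re s)"
    unfolding norm_mult using norm_eigenvalue_le[OF p \<alpha>] by (simp add: mult_right_mono)
  also have "\<dots> = real p powr (1 - Re s)"
    using p0 powr_add[of "real p" 1 "- Re s"] by simp
  finally show ?thesis .
qed

lemma local_factor_nonzero: "Re s > 1 \<Longrightarrow> local_factor A s p \<noteq> 0"
  using denominator_nonzero by (auto simp: local_factor_def euler_factor_def)

lemma L_nonzero: "Re s > 1 \<Longrightarrow> L s \<noteq> 0"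
  using has_prod_L[of s] local_factor_nonzero[of s] has_prod_0_iff by metis

text \<open>Each of the d denominators has modulus between \<open>w / 2\<close> and 2, because
  \<open>norm (\<alpha> * of_nat p powr (- s)) \<le> 2 powr (- w) \<le> 1 - w / 2\<close>.\<close>

lemma local_factor_bounds:
  assumes w: "0 < w" "w \<le> 1" and s: "Re s \<ge> 1 + w"
  shows "norm (local_factor A s p) \<le> (2 / w) ^ d" "norm (inverse (local_factor A s p)) \<le> 2 ^ d"
proof -
  have *: "w / 2 \<le> norm (1 - \<alpha> * of_nat p powr (- s)) \<and> norm (1 - \<alpha> * of_nat p powr (- s)) \<le> 2"
    if p: "prime p" and \<alpha>: "\<alpha> \<in># eigenvalues_mset (A p)" for \<alpha>
  proof -
    have "norm (\<alpha> * of_nat p powr (- s)) \<le> real p powr (1 - Re s)"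
      by (rule norm_eigenvalue_powr_le[OF p \<alpha>])
    also have "\<dots> \<le> real p powr (- w)"
      using prime_gt_1_nat[OF p] s by (intro powr_mono) auto
    also have "\<dots> \<le> 2 powr (- w)"
      using prime_ge_2_nat[OF p] w by (intro powr_mono2') auto
    \<comment> \<open>The convex function \<open>2 powr (- w)\<close> lies below its chord between w
      = 0 and w = 1.\<close>
    also have "\<dots> \<le> 1 - w / 2"
    proof -
      have "convex_on UNIV (\<lambda>x::real. exp (- (ln 2) * x))"
        by (intro convex_on_realI[where f' = "\<lambda>x. - (ln 2) * exp (- (ln 2) * x)"])
          (auto intro!: derivative_eq_intros mult_left_mono)
      then have "exp (- (ln 2) * ((1 - w) *\<^sub>R 0 + w *\<^sub>R 1)) \<le> (1 - w) * exp (- (ln 2) * 0) + w * exp (- (ln 2) * 1)"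
        by (rule convex_onD) (use w in auto)
      then show ?thesis by (simp add: powr_def exp_minus mult.commute)
    qed
    finally have y: "norm (\<alpha> * of_nat p powr (- s)) \<le> 1 - w / 2" .
    show ?thesis
      using norm_triangle_ineq2[of 1 "\<alpha> * of_nat p powr (- s)"]
        norm_triangle_ineq4[of 1 "\<alpha> * of_nat p powr (- s)"] y w
      by simp
  qed
  have 1: "norm (euler_factor A p s) \<le> (2 / w) ^ d" if p: "prime p"
    unfolding euler_factor_def norm_prod_mset_image size_eigenvalues[OF p, symmetric]
  proof (intro conjunct2[OF prod_mset_image_le_power] conjI)
    fix \<alpha> assume "\<alpha> \<in># eigenvalues_mset (A p)"
    from *[OF p this] show "norm (inverse (1 - \<alpha> * of_nat p powr (- s))) \<le> 2 / w"
      using w le_imp_inverse_le[of "w / 2" "norm (1 - \<alpha> * of_nat p powr (- s))"] by (simp add: norm_inverse)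
  qed auto
  have 2: "norm (inverse (euler_factor A p s)) \<le> 2 ^ d" if p: "prime p"
  proof -
    have "inverse (euler_factor A p s) = (\<Prod>\<alpha>\<in>#eigenvalues_mset (A p). 1 - \<alpha> * of_nat p powr (- s))"
    proof -
      have "inverse (\<Prod>\<alpha>\<in>#M. inverse (1 - \<alpha> * of_nat p powr (- s))) = (\<Prod>\<alpha>\<in>#M. 1 - \<alpha> * of_nat p powr (- s))" for M
        by (induction M) auto
      then show ?thesis unfolding euler_factor_def .
    qed
    moreover have "norm (\<Prod>\<alpha>\<in>#eigenvalues_mset (A p). 1 - \<alpha> * of_nat p powr (- s)) \<le> 2 ^ d"
      unfolding norm_prod_mset_image size_eigenvalues[OF p, symmetric]
      by (intro conjunct2[OF prod_mset_image_le_power] conjI) (use * p in auto)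
    ultimately show ?thesis by simp
  qed
  show "norm (local_factor A s p) \<le> (2 / w) ^ d" 
    using 1 w by (auto simp: local_factor_def one_le_power)
  show "norm (inverse (local_factor A s p)) \<le> 2 ^ d"
    using 2 by (auto simp: local_factor_def)
qed

lemma holomorphic_local_factor: "(\<lambda>s. local_factor A s p) holomorphic_on {s. Re s > 1}"
proof (cases "prime p")
  case True
  then have "(of_nat p :: complex) \<noteq> 0" by auto
  then show ?thesis using True denominator_nonzero
    unfolding local_factor_def euler_factor_def
    by (auto intro!: holomorphic_on_prod_mset holomorphic_intros)
qed (simp add: local_factor_def)

text \<open>With eigenvalues of modulus at most p and real part at least 7, each
  \<open>\<alpha> * of_nat p powr (- s)\<close> is at most \<open>1 / p ^ 6\<close>, and inverting
  the denominator loses a factor 2. The high power of p serves to absorb the degree d later.\<close>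

lemma local_factor_minus_1_le:
  assumes s: "Re s \<ge> 7" and p: "p \<ge> 1"
  shows "1 + norm (local_factor A s p - 1) \<le> exp (2 * real d / real p ^ 6)"
proof (cases "prime p")
  case True
  have "1 + norm (euler_factor A p s - 1) \<le> exp (2 / real p ^ 6 * size (eigenvalues_mset (A p)))"
    unfolding euler_factor_def
  proof (rule norm_prod_mset_minus_1_le)
    fix \<alpha> assume \<alpha>: "\<alpha> \<in># eigenvalues_mset (A p)"
    define y where "y = \<alpha> * of_nat p powr (- s)"
    have "norm y \<le> real p powr (1 - Re s)"
      unfolding y_def by (rule norm_eigenvalue_powr_le[OF True \<alpha>])
    also have "\<dots> \<le> real p powr (- 6)"
      using prime_gt_1_nat[OF True] s by (intro powr_mono) auto
    also have "\<dots> = 1 / real p ^ 6"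
      using prime_gt_1_nat[OF True] by (simp add: powr_minus divide_inverse powr_numeral)
    finally have y: "norm y \<le> 1 / real p ^ 6" .
    also have "\<dots> \<le> 1 / 2 ^ 6"
      using prime_ge_2_nat[OF True] by (intro divide_left_mono power_mono) auto
    also have "\<dots> \<le> 1/2" by simp
    finally have y2: "1 / 2 \<le> norm (1 - y)"
      using norm_triangle_ineq2[of 1 y] by simp
    then have "1 - y \<noteq> 0" by auto
    then have "inverse (1 - y) - 1 = y / (1 - y)" by (simp add: field_simps)
    then have "norm (inverse (1 - y) - 1) = norm y / norm (1 - y)" by (simp add: norm_divide)
    also have "\<dots> \<le> (1 / real p ^ 6) / (1 / 2)"
      using y y2 by (intro frac_le) auto
    finally show "norm (inverse (1 - \<alpha> * of_nat p powr (- s)) - 1) \<le> 2 / real p ^ 6"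
      by (simp add: y_def)
  qed
  then show ?thesis using True by (simp add: local_factor_def size_eigenvalues)
qed (auto simp: local_factor_def)

end

section \<open>The tail of the Euler product and its logarithm\<close>

lemma sum_inverse_squares_le:
  assumes "N \<ge> 1"
  shows "(\<Sum>n\<in>{N<..M}. 1 / real n ^ 2) \<le> 1 / real N"
proof (cases "N \<le> M")
  case True
  then have "(\<Sum>n\<in>{N<..M}. 1 / real n ^ 2) \<le> 1 / real N - 1 / real M"
  proof (induction M rule: dec_induct)
    case (step M)
    have "{N<..Suc M} = insert (Suc M) {N<..M}" using step by auto
    moreover have "1 / real (Suc M) ^ 2 \<le> 1 / real M - 1 / real (Suc M)"
    proof -
      have M: "real M > 0" using step assms by simp
      have "1 / real (Suc M) ^ 2 \<le> 1 / (real M * real (Suc M))"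
        using M by (intro divide_left_mono) (auto simp: power2_eq_square mult_right_mono)
      also have "\<dots> = 1 / real M - 1 / real (Suc M)"
        using M by (simp add: divide_simps)
      finally show ?thesis .
    qed
    ultimately show ?case using step by simp
  qed auto
  then show ?thesis by (rule order.trans) simp
qed auto

text \<open>\<open>exp (f - g)\<close> is identically 1, so differentiating shows that
  \<open>f - g\<close> has derivative 0 on the convex set S. It serves to compare an abstractly
  given logarithm with the principal one.\<close>

lemma exp_eq_imp_diff_constant:
  fixes f g :: "complex \<Rightarrow> complex"
  assumes S: "open S" "convex S" and hol: "f holomorphic_on S" "g holomorphic_on S"
    and eq: "\<And>z. z \<in> S \<Longrightarrow> exp (f z) = exp (g z)"
  obtains c where "exp c = 1" "\<And>z. z \<in> S \<Longrightarrow> f z = g z + c"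
proof (cases "S = {}")
  case True
  then show ?thesis using that[of 0] by auto
next
  case False
  then obtain z0 where z0: "z0 \<in> S" by auto
  define h where "h = (\<lambda>z. f z - g z)"
  have holh: "h holomorphic_on S" unfolding h_def by (intro holomorphic_intros hol)
  have exph: "exp (h z) = 1" if "z \<in> S" for z
    using eq[OF that] by (simp add: h_def exp_diff)
  have "(h has_field_derivative 0) (at z within S)" if z: "z \<in> S" for z
  proof -
    have d: "(h has_field_derivative deriv h z) (at z)"
      by (rule holomorphic_derivI[OF holh S(1) z])
    have "((\<lambda>z. exp (h z)) has_field_derivative exp (h z) * deriv h z) (at z)"
      by (auto intro!: derivative_eq_intros d)
    moreover have "((\<lambda>z. exp (h z)) has_field_derivative 0) (at z)"
    proof (rule has_field_derivative_transform_within_open[of "\<lambda>_. 1"])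
      show "((\<lambda>_. 1) has_field_derivative 0) (at z)" by simp
    qed (use S z exph in auto)
    ultimately have "deriv h z = 0" by (metis DERIV_unique exp_not_eq_zero mult_eq_0_iff)
    then show ?thesis using d by (metis has_field_derivative_at_within)
  qed
  then obtain c where c: "\<And>z. z \<in> S \<Longrightarrow> h z = c"
    using has_field_derivative_zero_constant[OF S(2)] by metis
  show ?thesis
    by (rule that[of c]) (use c exph[OF z0] z0 in \<open>auto simp: h_def algebra_simps\<close>)
qed

context
  fixes d :: nat and A :: "nat \<Rightarrow> complex mat" and L :: "complex \<Rightarrow> complex"
  assumes euler: "euler_product_condition d A L"
begin

text \<open>The total deviation of the factors beyond N is controlled by the sum of
  \<open>2 * d / p ^ 6\<close>. Two of the six powers of p make the sum converge; the other four
  absorb d, by \<open>d \<le> (N + 1)\<^sup>2\<close>, and still leave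
  \<open>1 / (N + 1)\<^sup>2\<close>.\<close>

lemma euler_tail_close_to_1:
  assumes s: "Re s \<ge> 7" and N: "N \<ge> 1" "real d \<le> real (N + 1) ^ 2"
  shows "norm (L s / (\<Prod>p\<le>N. local_factor A s p) - 1) \<le> 4 / real (N + 1) ^ 2"
proof -
  define f where "f = local_factor A s"
  define u where "u = 2 / real (N + 1) ^ 2"
  have nz: "f p \<noteq> 0" for p
    using local_factor_nonzero[OF euler, of s] s by (auto simp: f_def)
  have "2 \<le> real (N + 1) ^ 2" using N power_mono[of 2 "real (N + 1)" 2] by simp
  then have u: "0 \<le> u" "u \<le> 1" by (auto simp: u_def)
  have expu: "exp u \<le> 1 + 2 * u"
    using exp_bound[OF u] mult_left_mono[OF u(2) u(1)] by (simp add: power2_eq_square)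
  have fin: "norm ((\<Prod>p\<in>{N<..M}. f p) - 1) \<le> 2 * u" for M
  proof -
    have "norm ((\<Prod>p\<in>{N<..M}. f p) - 1) \<le> (\<Prod>p\<in>{N<..M}. 1 + norm (f p - 1)) - 1"
      using norm_prod_minus1_le_prod_minus1[of "\<lambda>p. f p - 1" "{N<..M}"] by simp
    also have "(\<Prod>p\<in>{N<..M}. 1 + norm (f p - 1)) \<le> (\<Prod>p\<in>{N<..M}. exp (2 * real d / real p ^ 6))"
      using N by (intro prod_mono) (auto simp: f_def intro!: local_factor_minus_1_le[OF euler s])
    also have "\<dots> = exp (\<Sum>p\<in>{N<..M}. 2 * real d / real p ^ 6)"
      by (simp add: exp_sum)
    also have "(\<Sum>p\<in>{N<..M}. 2 * real d / real p ^ 6) \<le> (\<Sum>p\<in>{N<..M}. u * (1 / real p ^ 2))"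
    proof (rule sum_mono)
      fix p assume "p \<in> {N<..M}"
      then have p: "real p \<ge> real (N + 1)" by auto
      then have p0: "real p > 0" using N by linarith
      have "real d * real (N + 1) ^ 2 \<le> real (N + 1) ^ 2 * real (N + 1) ^ 2"
        using N by (intro mult_right_mono) auto
      also have "\<dots> \<le> real p ^ 2 * real p ^ 2"
        using p N by (intro mult_mono power_mono) auto
      finally have "real d * real (N + 1) ^ 2 \<le> real p ^ 4" by (simp flip: power_add)
      then have "real d / real p ^ 4 \<le> 1 / real (N + 1) ^ 2"
        using p0 N by (simp add: divide_simps del: of_nat_add)
      then have "2 * (real d / real p ^ 4) * (1 / real p ^ 2) \<le> u * (1 / real p ^ 2)"
        unfolding u_def by (intro mult_right_mono) auto
      moreover have "2 * (real d / real p ^ 4) * (1 / real p ^ 2) = 2 * real d / real p ^ 6"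
        by (simp flip: power_add)
      ultimately show "2 * real d / real p ^ 6 \<le> u * (1 / real p ^ 2)" by simp
    qed
    also have "\<dots> \<le> u * 1"
      unfolding sum_distrib_left[symmetric]
      using order.trans[OF sum_inverse_squares_le[OF N(1), of M], of 1] u N
      by (intro mult_left_mono) auto
    finally show ?thesis using expu by simp
  qed
  have "(\<lambda>M. prod f {..M}) \<longlonglongrightarrow> L s"
    unfolding f_def by (rule has_prod_imp_tendsto[OF has_prod_L[OF euler]]) (use s in auto)
  then have "(\<lambda>M. norm (prod f {..M} / prod f {..N} - 1)) \<longlonglongrightarrow> norm (L s / prod f {..N} - 1)"
    using nz by (intro tendsto_intros) auto
  then have "norm (L s / prod f {..N} - 1) \<le> 2 * u"
  proof (rule tendsto_upperbound)
    have "norm (prod f {..M} / prod f {..N} - 1) \<le> 2 * u" if "M \<ge> N" for M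
    proof -
      have "prod f {..M} = prod f {..N} * prod f {N<..M}"
        using that by (subst prod.union_disjoint[symmetric]) (auto intro!: prod.cong)
      then show ?thesis using fin[of M] nz by simp
    qed
    then show "eventually (\<lambda>M. norm (prod f {..M} / prod f {..N} - 1) \<le> 2 * u) sequentially"
      by (auto simp: eventually_sequentially)
  qed auto
  then show ?thesis by (simp add: f_def u_def)
qed

text \<open>Split off the primes up to \<open>exp \<Delta>\<close>: on
  \<open>Re s \<ge> 1 + w\<close> their product and its inverse are at most \<open>exp H\<close>.
  The logarithm of the rest is tiny for \<open>Re s > 7\<close> and has real part bounded through
  \<open>bound\<close> further left, so \<open>norm_le_quarter_of_Re_le\<close> divides that bound
  by 4. Moving the ordinate inside the rectangle doubles it first, which leaves
  \<open>K / 2\<close>.\<close>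

lemma euler_product_log_bound_step:
  assumes hol: "L holomorphic_on {s. Re s > 1}"
    and \<Delta>: "\<Delta> \<ge> 1344" and d\<Delta>: "real d \<le> exp (2 * \<Delta>)" and w: "w = 168 / \<Delta>"
    and H: "H \<ge> real d * \<Delta> * exp \<Delta>" "H \<ge> 1" and K: "K \<ge> 0"
    and bound: "\<And>s. Re s \<ge> 1 + w \<Longrightarrow> norm (L s) \<le> exp (K * (H + real d * \<bar>Im s\<bar>))"
    and s: "Re s \<ge> 1 + 2 * w"
  shows "norm (L s) \<le> exp (K / 2 * (H + real d * \<bar>Im s\<bar>) + 2 * H)"
proof -
  define x where "x = exp \<Delta>"
  define N where "N = nat \<lfloor>x\<rfloor>"
  define P where "P = (\<lambda>s. \<Prod>p\<le>N. local_factor A s p)"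
  define G where "G = (\<lambda>s. L s / P s)"
  have "1 + \<Delta> \<le> x" unfolding x_def by (rule exp_ge_add_one_self)
  then have x: "x \<ge> 1345" using \<Delta> by linarith
  have N: "real N \<le> x" "x \<le> real (N + 1)" using x unfolding N_def by linarith+
  then have N1: "N \<ge> 1" using x by linarith
  have wpos: "0 < w" "w \<le> 1/8" using \<Delta> by (auto simp: w field_simps)
  have \<Delta>w: "\<Delta> * w = 168" using \<Delta> by (simp add: w)
  have Pnz: "P s \<noteq> 0" if "Re s > 1" for s
    using local_factor_nonzero[OF euler that] by (simp add: P_def)
  have Gnz: "G s \<noteq> 0" if "Re s > 1" for s
    using Pnz[OF that] L_nonzero[OF euler that] by (simp add: G_def)
  have holG: "G holomorphic_on {s. Re s > 1}"
    unfolding G_def P_def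
    by (intro holomorphic_intros hol holomorphic_local_factor[OF euler]) (use Pnz in \<open>auto simp: P_def\<close>)
  \<comment> \<open>The index range \<open>p \<le> N\<close> contains 0, hence the
    \<open>N + 1\<close> factors.\<close>
  have exponent: "real d * real (N + 1) \<le> real d * (2 * x)"
    using N x by (intro mult_left_mono) auto
  have Hx: "real d * x * \<Delta> \<le> H" using H by (simp add: x_def mult_ac)
  have "real d * x * 2 \<le> real d * x * \<Delta>" using x \<Delta> by (intro mult_left_mono) auto
  then have Hx2: "real d * (2 * x) \<le> H" using Hx by simp
  have "real d * 7 \<le> real d * (2 * x)" using x by (intro mult_left_mono) auto
  then have Hd: "7 * real d \<le> H" using Hx2 by simp
  \<comment> \<open>With \<open>2 / w = \<Delta> / 84\<close> and \<open>y \<le> exp y\<close>, the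
    exponent is at most \<open>real d * (2 * x) * \<Delta> / 84\<close>, that is, at most
    \<open>H / 42\<close>.\<close>
  have P1: "norm (P s) \<le> exp H" if "Re s \<ge> 1 + w" for s
  proof -
    have "norm (P s) \<le> (\<Prod>p\<le>N. (2 / w) ^ d)"
      unfolding P_def prod_norm[symmetric]
      by (intro prod_mono) (use local_factor_bounds(1)[OF euler _ _ that] wpos in auto)
    also have "\<dots> = (2 / w) ^ (d * (N + 1))" by (simp add: power_mult power_add)
    also have "2 / w = \<Delta> / 84" using \<Delta> by (simp add: w)
    also have "(\<Delta> / 84) ^ (d * (N + 1)) \<le> exp (\<Delta> / 84) ^ (d * (N + 1))"
      using \<Delta> by (intro power_mono order.trans[OF _ exp_ge_add_one_self[of "\<Delta> / 84"]]) auto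
    also have "\<dots> = exp (real d * real (N + 1) * (\<Delta> / 84))"
      by (simp add: distrib_left flip: exp_of_nat_mult)
    also have "real d * real (N + 1) * (\<Delta> / 84) \<le> real d * (2 * x) * (\<Delta> / 84)"
      using exponent \<Delta> by (intro mult_right_mono) auto
    also have "\<dots> \<le> H" using Hx H(2) by (simp add: mult_ac)
    finally show ?thesis by simp
  qed
  have P2: "norm (inverse (P s)) \<le> exp H" if "Re s \<ge> 1 + w" for s
  proof -
    have "norm (inverse (P s)) = (\<Prod>p\<le>N. norm (inverse (local_factor A s p)))"
      unfolding P_def prod_norm by (simp add: prod_inversef[symmetric] o_def)
    also have "\<dots> \<le> (\<Prod>p\<le>N. 2 ^ d)"
      by (intro prod_mono) (use local_factor_bounds(2)[OF euler _ _ that] wpos in auto)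
    also have "\<dots> = 2 ^ (d * (N + 1))" by (simp add: power_mult power_add)
    also have "\<dots> \<le> exp 1 ^ (d * (N + 1))"
      using exp_ge_add_one_self[of 1] by (intro power_mono) auto
    also have "\<dots> = exp (real d * real (N + 1))"
      by (simp add: distrib_left flip: exp_of_nat_mult)
    finally show ?thesis using exponent Hx2 by (auto intro: order.trans)
  qed
  obtain f0 where f0: "f0 holomorphic_on {s. Re s > 1}" "\<And>s. Re s > 1 \<Longrightarrow> exp (f0 s) = G s"
    using holomorphic_logarithm_exists[OF convex_halfspace_Re_gt open_halfspace_Re_gt holG, of 2]
      Gnz by auto
  have near1: "norm (G s - 1) \<le> 4 / x ^ 2" if "Re s > 7" for s
  proof -
    have "real d \<le> x ^ 2" using d\<Delta> by (simp add: x_def flip: exp_of_nat_mult)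
    also have "\<dots> \<le> real (N + 1) ^ 2" using N x by (intro power_mono) auto
    finally have "norm (G s - 1) \<le> 4 / real (N + 1) ^ 2"
      unfolding G_def P_def using that N1 by (intro euler_tail_close_to_1) auto
    also have "\<dots> \<le> 4 / x ^ 2"
      using N x by (intro divide_left_mono power_mono mult_pos_pos) auto
    finally show ?thesis .
  qed
  have x2: "8 / x ^ 2 \<le> 1 / x" "4 / x ^ 2 < 1 / 2"
  proof -
    show 1: "8 / x ^ 2 \<le> 1 / x" using x by (simp add: field_simps power2_eq_square)
    have "1345\<^sup>2 \<le> x ^ 2" using x by (intro power_mono) auto
    then show "4 / x ^ 2 < 1 / 2" using x by (simp add: field_simps)
  qed
  have LnG: "norm (Ln (G s)) \<le> exp (- \<Delta>)" "G s \<notin> \<real>\<^sub>\<le>\<^sub>0" if "Re s > 7" for s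
  proof -
    have "norm (G s - 1) < 1 / 2" using near1[OF that] x2 by simp
    then have "norm (Ln (1 + (G s - 1))) \<le> 2 * norm (G s - 1)" by (rule norm_Ln_le)
    then have "norm (Ln (G s)) \<le> 1 / x" using near1[OF that] x2 by simp
    then show "norm (Ln (G s)) \<le> exp (- \<Delta>)" by (simp add: x_def exp_minus inverse_eq_divide)
    have "\<bar>Re (G s - 1)\<bar> < 1 / 2" using \<open>norm (G s - 1) < 1 / 2\<close> abs_Re_le_cmod by (rule le_less_trans[rotated])
    then show "G s \<notin> \<real>\<^sub>\<le>\<^sub>0" by (auto simp: complex_nonpos_Reals_iff)
  qed
  \<comment> \<open>The logarithm \<open>f0\<close> is determined only up to a period of exp; c is
    the period by which it differs from the principal logarithm on \<open>Re s > 7\<close>, where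
    the latter is small.\<close>
  obtain c where c: "exp c = 1" "\<And>s. Re s > 7 \<Longrightarrow> f0 s = Ln (G s) + c"
  proof (rule exp_eq_imp_diff_constant[of "{s. Re s > 7}" f0 "\<lambda>s. Ln (G s)"])
    show "f0 holomorphic_on {s. Re s > 7}" by (rule holomorphic_on_subset[OF f0(1)]) auto
    show "(\<lambda>s. Ln (G s)) holomorphic_on {s. Re s > 7}"
      using LnG(2) by (intro holomorphic_intros holomorphic_on_subset[OF holG]) auto
    show "exp (f0 z) = exp (Ln (G z))" if "z \<in> {s. Re s > 7}" for z
      using that f0(2)[of z] Gnz[of z] by simp
  qed (auto simp: convex_halfspace_Re_gt open_halfspace_Re_gt)
  \<comment> \<open>After this shift the rectangle lies in \<open>Re s \<ge> 1 + w\<close>, where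
    \<open>bound\<close> applies, its right side lies in \<open>Re s > 7\<close>, and s itself
    corresponds to the point w.\<close>
  define s0 where "s0 = s - of_real w"
  define f where "f = (\<lambda>z. f0 (s0 + z) - c)"
  define B where "B = K * (H + real d * \<bar>Im s\<bar>)"
  have Re_s0: "Re s0 \<ge> 1 + w" using s by (simp add: s0_def)
  have expf: "exp (f z) = G (s0 + z)" if "Re z \<ge> 0" for z
    using f0(2)[of "s0 + z"] c(1) that Re_s0 wpos by (simp add: f_def exp_diff)
  have "norm (f (of_real w)) \<le> (2 * B + H) / 4"
  proof (rule norm_le_quarter_of_Re_le[where \<Delta> = \<Delta>])
    show "f holomorphic_on cbox (Complex 0 (- 7)) (Complex 6 7)"
    proof -
      have "(f0 \<circ> (\<lambda>z. s0 + z)) holomorphic_on cbox (Complex 0 (- 7)) (Complex 6 7)"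
        using Re_s0 wpos
        by (intro holomorphic_on_compose_gen[OF _ f0(1)] holomorphic_intros)
          (auto simp: in_cbox_complex_iff)
      then show ?thesis unfolding f_def o_def by (intro holomorphic_intros)
    qed
    have "B \<ge> 0" using K H unfolding B_def by (intro mult_nonneg_nonneg add_nonneg_nonneg) auto
    then show "2 * B + H \<ge> 1" using H by simp
    show "Re (f z) \<le> 2 * B + H" if z: "z \<in> cbox (Complex 0 (- 7)) (Complex 6 7)" for z
    proof -
      have z': "0 \<le> Re z" "\<bar>Im z\<bar> \<le> 7" using z by (auto simp: in_cbox_complex_iff)
      have Re: "Re (s0 + z) \<ge> 1 + w" using Re_s0 z' by simp
      have "real d * \<bar>Im (s0 + z)\<bar> \<le> real d * (\<bar>Im s\<bar> + 7)"
        using z' by (intro mult_left_mono) (auto simp: s0_def)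
      \<comment> \<open>The ordinate moves by at most 7, and
        \<open>7 * real d \<le> H\<close>.\<close>
      then have "H + real d * \<bar>Im (s0 + z)\<bar> \<le> 2 * (H + real d * \<bar>Im s\<bar>)"
        using Hd mult_nonneg_nonneg[of "real d" "\<bar>Im s\<bar>"] unfolding distrib_left by linarith
      from mult_left_mono[OF this K] have "K * (H + real d * \<bar>Im (s0 + z)\<bar>) \<le> 2 * B"
        by (simp add: B_def algebra_simps)
      with bound[OF Re] have "norm (L (s0 + z)) \<le> exp (2 * B)"
        by (meson exp_le_cancel_iff order.trans)
      then have "norm (G (s0 + z)) \<le> exp (2 * B) * exp H"
        unfolding G_def divide_inverse norm_mult using P2[OF Re] by (intro mult_mono) auto
      then have "exp (Re (f z)) \<le> exp (2 * B + H)"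
        using expf[OF z'(1)] by (metis norm_exp_eq_Re exp_add)
      then show ?thesis by simp
    qed
    show "norm (f z) \<le> exp (- \<Delta>)" if "Re z = 6" for z
    proof -
      have "Re (s0 + z) > 7" using that Re_s0 wpos by simp
      then show ?thesis using c(2) LnG(1) by (simp add: f_def)
    qed
  qed (use \<Delta> wpos \<Delta>w in auto)
  then have "Re (f (of_real w)) \<le> B / 2 + H"
    using complex_Re_le_cmod[of "f (of_real w)"] H by (simp add: field_simps)
  then have "norm (exp (f (of_real w))) \<le> exp (B / 2 + H)" by simp
  moreover have "exp (f (of_real w)) = G s"
    using expf[of "of_real w"] wpos by (simp add: s0_def)
  ultimately have "norm (G s) \<le> exp (B / 2 + H)" by simp
  moreover have "L s = G s * P s" using Pnz[of s] s wpos by (simp add: G_def)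
  ultimately have "norm (L s) \<le> exp (B / 2 + H) * exp H"
    using P1[of s] s wpos by (auto simp: norm_mult intro!: mult_mono)
  then show ?thesis by (simp add: B_def add_ac flip: exp_add)
qed

end

section \<open>Gamma factors and the functional equation\<close>

lemma norm_Gamma_le:
  assumes "Re z > 0"
  shows "norm (Gamma z) \<le> Gamma (Re z)"
proof -
  have "norm (integral {0..} (\<lambda>t. of_real t powr (z - 1) / of_real (exp t)))
          \<le> integral {0..} (\<lambda>t. t powr (Re z - 1) / exp t)"
  proof (rule integral_norm_bound_integral)
    show "(\<lambda>t. of_real t powr (z - 1) / of_real (exp t)) integrable_on {0..}"
      using Gamma_integral_complex[OF assms] by (rule has_integral_integrable)
    show "(\<lambda>t. t powr (Re z - 1) / exp t) integrable_on {0..}"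
      using Gamma_integral_real[OF assms] by (rule has_integral_integrable)
    show "norm (of_real t powr (z - 1) / of_real (exp t)) \<le> t powr (Re z - 1) / exp t"
      if "t \<in> {0..}" for t
      using that by (simp add: norm_divide norm_powr_real_powr)
  qed
  then show ?thesis
    using integral_unique[OF Gamma_integral_complex[OF assms]]
      integral_unique[OF Gamma_integral_real[OF assms]] by simp
qed

text \<open>Shift the argument by n until its real part is at least 1; there
  \<open>norm_Gamma_le\<close> reduces the claim to a compact real interval. The shift only helps,
  since each factor \<open>z + k\<close> of the Pochhammer symbol has modulus at least
  \<open>\<bar>Im z\<bar> \<ge> 1\<close>.\<close>

lemma Gamma_bounded_off_real_axis:
  obtains K where "K \<ge> 0" "\<And>z. p \<le> Re z \<Longrightarrow> Re z \<le> q \<Longrightarrow> \<bar>Im z\<bar> \<ge> 1 \<Longrightarrow> norm (Gamma z) \<le> K"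
proof -
  define n where "n = nat \<lceil>1 - p\<rceil>"
  have n: "p + real n \<ge> 1" by (simp add: n_def) linarith
  have "compact (Gamma ` {p + real n..q + real n})"
    by (intro compact_continuous_image continuous_on_Gamma compact_Icc)
      (use n in \<open>auto elim!: nonpos_Ints_cases\<close>)
  then obtain K where K: "\<And>x. x \<in> {p + real n..q + real n} \<Longrightarrow> \<bar>Gamma x\<bar> \<le> K"
    using compact_imp_bounded by (fastforce simp: bounded_iff)
  show ?thesis
  proof (rule that[of "\<bar>K\<bar>"])
    fix z assume z: "p \<le> Re z" "Re z \<le> q" "\<bar>Im z\<bar> \<ge> 1"
    have nonint: "z \<notin> \<int>\<^sub>\<le>\<^sub>0" using z(3) by (auto elim!: nonpos_Ints_cases)
    have "1 \<le> norm (pochhammer z n)"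
    proof -
      have "1 \<le> norm (z + of_nat k)" for k
        using abs_Im_le_cmod[of "z + of_nat k"] z(3) by simp
      then have "(\<Prod>k<n. 1) \<le> (\<Prod>k<n. norm (z + of_nat k))" by (intro prod_mono) auto
      then show ?thesis by (simp add: pochhammer_prod prod_norm lessThan_atLeast0)
    qed
    then have "norm (Gamma z) \<le> norm (pochhammer z n) * norm (Gamma z)"
      using mult_right_mono[of 1 "norm (pochhammer z n)" "norm (Gamma z)"] by simp
    also have "\<dots> = norm (Gamma (z + of_nat n))"
      using pochhammer_Gamma[OF nonint, of n] nonint by (simp add: Gamma_eq_zero_iff norm_divide)
    also have "\<dots> \<le> Gamma (Re (z + of_nat n))"
      by (rule norm_Gamma_le) (use n z in auto)
    also have "\<dots> \<le> \<bar>K\<bar>" using K[of "Re z + real n"] z by auto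
    finally show "norm (Gamma z) \<le> \<bar>K\<bar>" .
  qed auto
qed

text \<open>By the reflection formula, \<open>inverse (Gamma z)\<close> is
  \<open>Gamma (1 - z)\<close> times \<open>sin (pi * z) / pi\<close>. The resulting simple
  exponential growth is harmless for a Phragmen-Lindelof argument.\<close>

lemma norm_inverse_Gamma_le:
  assumes "\<bar>Im z\<bar> \<ge> 1"
  shows "norm (inverse (Gamma z)) \<le> exp (pi * \<bar>Im z\<bar>) * norm (Gamma (1 - z))"
proof -
  have "1 - z \<notin> \<int>\<^sub>\<le>\<^sub>0" using assms by (auto elim!: nonpos_Ints_cases simp: complex_eq_iff)
  then have "rGamma (1 - z) \<noteq> 0" by (simp add: rGamma_eq_zero_iff)
  then have "rGamma z = sin (of_real pi * z) / of_real pi / rGamma (1 - z)"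
    using rGamma_reflection_complex[of z] by (metis nonzero_eq_divide_eq)
  then have "inverse (Gamma z) = sin (of_real pi * z) / of_real pi * Gamma (1 - z)"
    by (simp add: rGamma_inverse_Gamma divide_inverse mult_ac)
  then have "norm (inverse (Gamma z)) = norm (sin (of_real pi * z)) / pi * norm (Gamma (1 - z))"
    by (simp add: norm_mult norm_divide)
  also have "\<dots> \<le> exp (pi * \<bar>Im z\<bar>) / 1 * norm (Gamma (1 - z))"
    using cmod_sin_le_exp[of 1 "of_real pi * z"] pi_gt3
    by (intro mult_right_mono frac_le) (auto simp: abs_mult)
  finally show ?thesis by simp
qed

section \<open>Consequences of the functional equation\<close>

lemma functional_equation_sym:
  assumes "functional_equation d Q \<beta> \<omega> L L'" "norm \<omega> = 1"
  shows "functional_equation d Q (\<lambda>i. cnj (\<beta> i)) (inverse \<omega>) L' L"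
  unfolding functional_equation_def
proof (intro allI impI)
  fix s assume s: "s \<noteq> 0 \<and> s \<noteq> 1 \<and> (\<forall>i\<in>{1..d}. (1 - s) / 2 + cnj (\<beta> i) \<notin> \<int>\<^sub>\<le>\<^sub>0 \<and> s / 2 + cnj (cnj (\<beta> i)) \<notin> \<int>\<^sub>\<le>\<^sub>0)"
  have "\<omega> \<noteq> 0" using assms(2) by auto
  have "completed_L d Q \<beta> L (1 - (1 - s)) = \<omega> * completed_L d Q (\<lambda>i. cnj (\<beta> i)) L' (1 - s)"
    using assms(1)[unfolded functional_equation_def, rule_format, of "1 - s"] s by auto
  then show "completed_L d Q (\<lambda>i. cnj (\<beta> i)) L' (1 - s)
      = inverse \<omega> * completed_L d Q (\<lambda>i. cnj (cnj (\<beta> i))) L s"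
    using \<open>\<omega> \<noteq> 0\<close> by simp
qed

text \<open>The Gamma factors on the side of L are divided out and become values of the entire
  function \<open>rGamma\<close>, for which limits are immediate.\<close>

lemma functional_equation_solved:
  assumes fe: "functional_equation d Q \<beta> \<omega> L L'" and Q: "Q \<noteq> 0"
    and s: "s \<noteq> 0" "s \<noteq> 1"
    and reg: "\<And>i. i \<in> {1..d} \<Longrightarrow> (1 - s) / 2 + \<beta> i \<notin> \<int>\<^sub>\<le>\<^sub>0 \<and> s / 2 + cnj (\<beta> i) \<notin> \<int>\<^sub>\<le>\<^sub>0"
  shows "L (1 - s) = \<omega> * Q powr (s - 1 / 2) *
    (\<Prod>i=1..d. Gamma (s / 2 + cnj (\<beta> i)) * rGamma ((1 - s) / 2 + \<beta> i)) * L' s"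
proof -
  have eq: "Q powr ((1 - s) / 2) * (\<Prod>i=1..d. Gamma ((1 - s) / 2 + \<beta> i)) * L (1 - s) =
      \<omega> * (Q powr (s / 2) * (\<Prod>i=1..d. Gamma (s / 2 + cnj (\<beta> i))) * L' s)"
    using fe[unfolded functional_equation_def completed_L_def, rule_format, of s] s reg by auto
  have nz: "Q powr ((1 - s) / 2) \<noteq> 0" "(\<Prod>i=1..d. Gamma ((1 - s) / 2 + \<beta> i)) \<noteq> 0"
    using Q reg by (auto simp: Gamma_eq_zero_iff)
  have "Q powr (s - 1 / 2) = Q powr (s / 2) / Q powr ((1 - s) / 2)"
  proof -
    have "s - 1 / 2 = s / 2 - (1 - s) / 2" by (simp add: field_simps)
    then show ?thesis by (simp add: powr_diff)
  qed
  moreover have "X = \<omega> * (b / a) * (q / p) * Y"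
    if "a \<noteq> 0" "p \<noteq> 0" "a * p * X = \<omega> * (b * q * Y)" for a b p q X Y :: complex
    using that by (simp add: field_simps)
  note this[OF nz eq]
  moreover have "(\<Prod>i=1..d. Gamma (s / 2 + cnj (\<beta> i)) * rGamma ((1 - s) / 2 + \<beta> i)) =
      (\<Prod>i=1..d. Gamma (s / 2 + cnj (\<beta> i))) / (\<Prod>i=1..d. Gamma ((1 - s) / 2 + \<beta> i))"
    by (simp add: rGamma_inverse_Gamma prod_dividef flip: divide_inverse)
  ultimately show ?thesis by simp
qed

text \<open>Q is complex, so its argument contributes as well, by at most
  \<open>pi * \<bar>Im z\<bar>\<close> in the exponent.\<close>

lemma norm_powr_le_exp_Im:
  "norm (Q powr z) \<le> norm Q powr Re z * exp (pi * \<bar>Im z\<bar>)"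
proof -
  have "\<bar>Arg Q\<bar> \<le> pi" using Arg_bounded[of Q] by auto
  then have "- Im z * Arg Q \<le> \<bar>Im z\<bar> * pi"
    using abs_ge_self[of "- Im z * Arg Q"]
      mult_left_mono[of "\<bar>Arg Q\<bar>" pi "\<bar>Im z\<bar>"] by (simp add: abs_mult)
  then show ?thesis unfolding norm_powr_complex by (simp add: mult_left_mono mult.commute)
qed

text \<open>The first bound makes the logarithm of the conductor at least \<open>d * ln 3\<close>.
  The second is the shape in which the conductor arises on \<open>Re s = 3 / 2\<close>, where the
  exponent \<open>s - 1 / 2\<close> of Q has real part 1.\<close>

lemma conductor_bounds:
  "conductor d Q \<beta> \<ge> 3 ^ d"
  "norm Q * (\<Prod>j=1..d. 3 + norm (\<beta> j)) \<le> conductor d Q \<beta>"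
proof -
  have 1: "(3::real) ^ d \<le> (\<Prod>j=1..d. 3 + norm (\<beta> j))"
    using prod_mono[of "{1..d}" "\<lambda>_. 3::real" "\<lambda>j. 3 + norm (\<beta> j)"] by simp
  then have 2: "(0::real) \<le> (\<Prod>j=1..d. 3 + norm (\<beta> j))"
    using zero_le_power[of "3::real" d] by linarith
  show "conductor d Q \<beta> \<ge> 3 ^ d"
    unfolding conductor_def using mult_mono[of 1 "1 + norm Q", OF _ 1] by simp
  show "norm Q * (\<Prod>j=1..d. 3 + norm (\<beta> j)) \<le> conductor d Q \<beta>"
    unfolding conductor_def using 2 by (intro mult_right_mono) auto
qed

text \<open>At a pole, \<open>zor_poly\<close> supplies the missing value; it is nonzero because the
  order is exactly m. This nonvanishing is what \<open>pole_order_le_degree\<close>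
  contradicts.\<close>

lemma continuation_pole_removed:
  assumes "continuation_condition m L"
  obtains g where "g holomorphic_on UNIV" "\<And>s. s \<noteq> 1 \<Longrightarrow> g s = (s - 1) ^ m * L s" "0 < m \<Longrightarrow> g 1 \<noteq> 0"
proof (cases "m = 0")
  case True
  then have "L analytic_on {1}" "L holomorphic_on - {1}"
    using assms by (auto simp: continuation_condition_def)
  moreover have "open (- {1::complex})" by auto
  ultimately have "L analytic_on {1} \<union> - {1}"
    using analytic_on_Un analytic_on_open by blast
  moreover have "{1} \<union> - {1} = (UNIV :: complex set)" by auto
  ultimately have "L holomorphic_on UNIV"
    by (metis analytic_imp_holomorphic)
  then show ?thesis using True by (intro that[of L]) auto
next
  case False
  then have L: "L holomorphic_on UNIV - {1}" "is_pole L 1" "zorder L 1 = - int m"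
    using assms by (auto simp: continuation_condition_def Compl_eq_Diff_UNIV)
  define h where "h = zor_poly L 1"
  obtain r where h: "h 1 \<noteq> 0" and r: "r > 0" "h holomorphic_on cball 1 r"
    "\<And>w. w \<in> cball 1 r - {1} \<Longrightarrow> L w = h w / (w - 1) ^ m"
    using zorder_exist_pole[OF L(1) _ _ L(2)] L(3) by (auto simp: h_def)
  have "isCont h 1"
    using r by (intro continuous_on_interior[OF holomorphic_on_imp_continuous_on]) auto
  then have "h \<midarrow>1\<rightarrow> h 1" by (simp add: isCont_def)
  moreover have "eventually (\<lambda>w. h w = (w - 1) ^ m * L w) (at 1)"
    unfolding eventually_at using r by (intro exI[of _ r]) (auto simp: dist_commute)
  ultimately have lim: "(\<lambda>w. (w - 1) ^ m * L w) \<midarrow>1\<rightarrow> h 1"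
    by (rule Lim_transform_eventually)
  define g where "g = (\<lambda>w. if w = 1 then h 1 else (w - 1) ^ m * L w)"
  have "g holomorphic_on UNIV"
    unfolding g_def
    by (rule removable_singularity[OF _ open_UNIV lim]) (intro holomorphic_intros L)
  then show ?thesis using h by (intro that[of g]) (auto simp: g_def)
qed

text \<open>Approach \<open>s = 0\<close> from the right: there \<open>L'\<close> is regular and each factor
  \<open>Gamma (s / 2 + cnj (\<beta> i))\<close> has at most a simple pole, so \<open>L (1 - s)\<close> is \<open>O(s\<^sup>-\<^sup>d)\<close>.\<close>

lemma pole_order_le_degree:
  assumes cont: "continuation_condition m L" "continuation_condition m' L'"
    and \<beta>: "\<forall>i\<in>{1..d}. Re (\<beta> i) > - 1 / 2" and Q: "Q \<noteq> 0"
    and fe: "functional_equation d Q \<beta> \<omega> L L'"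
  shows "m \<le> d"
proof (rule ccontr)
  assume "\<not> m \<le> d"
  then have m: "0 < m" "d < m" by auto
  obtain g where g: "g holomorphic_on UNIV" "\<And>s. s \<noteq> 1 \<Longrightarrow> g s = (s - 1) ^ m * L s" "g 1 \<noteq> 0"
    using continuation_pole_removed[OF cont(1)] m by metis
  let ?F = "at_right (0::real)"
  let ?s = "\<lambda>x::real. complex_of_real x"
  have s0: "(?s \<longlongrightarrow> 0) ?F"
    using tendsto_of_real[OF tendsto_ident_at, of 0 "{0<..}"] by simp
  have ev0: "eventually (\<lambda>x. x > 0) ?F" by (rule eventually_at_right_less)
  have "eventually (\<lambda>x. x < 1) ?F"
    by (rule order_tendstoD(2)[OF tendsto_ident_at]) simp
  with ev0 have pos: "eventually (\<lambda>x. x > 0 \<and> x < 1) ?F" by eventually_elim auto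
  have reg: "eventually (\<lambda>x. (1 - ?s x) / 2 + \<beta> i \<notin> \<int>\<^sub>\<le>\<^sub>0 \<and> ?s x / 2 + cnj (\<beta> i) \<notin> \<int>\<^sub>\<le>\<^sub>0) ?F"
    if i: "i \<in> {1..d}" for i
  proof -
    have b: "Re (\<beta> i) > - 1 / 2" using \<beta> i by auto
    \<comment> \<open>For x below e, \<open>(1 - x) / 2 + \<beta> i\<close> has positive real part.
      The real part of \<open>x / 2 + cnj (\<beta> i)\<close> exceeds -1/2, so only the value 0 must
      be avoided, which would need \<open>x = - 2 * Re (\<beta> i)\<close>.\<close>
    define e where "e = min (1 + 2 * Re (\<beta> i)) (if Re (\<beta> i) < 0 then - 2 * Re (\<beta> i) else 1)"
    have "e > 0" using b by (auto simp: e_def)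
    then have "eventually (\<lambda>x. x < e) ?F"
      by (rule order_tendstoD(2)[OF tendsto_ident_at])
    then show ?thesis using ev0
    proof eventually_elim
      case (elim x)
      have 1: "x < 1 + 2 * Re (\<beta> i)" "Re (\<beta> i) < 0 \<Longrightarrow> x < - 2 * Re (\<beta> i)"
        using elim by (auto simp: e_def)
      have "(1 - ?s x) / 2 + \<beta> i \<notin> \<int>\<^sub>\<le>\<^sub>0"
      proof
        assume "(1 - ?s x) / 2 + \<beta> i \<in> \<int>\<^sub>\<le>\<^sub>0"
        then obtain n where "(1 - ?s x) / 2 + \<beta> i = of_int n" "n \<le> 0" by (rule nonpos_Ints_cases)
        then have "Re ((1 - ?s x) / 2 + \<beta> i) \<le> 0" by simp
        then show False using 1(1) by (simp add: field_simps)
      qed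
      moreover have "?s x / 2 + cnj (\<beta> i) \<notin> \<int>\<^sub>\<le>\<^sub>0"
      proof
        assume "?s x / 2 + cnj (\<beta> i) \<in> \<int>\<^sub>\<le>\<^sub>0"
        then obtain n where n: "?s x / 2 + cnj (\<beta> i) = of_int n" "n \<le> 0" by (rule nonpos_Ints_cases)
        then have re: "x / 2 + Re (\<beta> i) = of_int n" by (simp add: complex_eq_iff)
        then have "real_of_int n > -1" using b elim by simp
        then have "n = 0" using n by linarith
        then have "x = - 2 * Re (\<beta> i)" using re by simp
        then show False using 1 elim by auto
      qed
      ultimately show ?case by blast
    qed
  qed
  have "\<exists>l. ((\<lambda>x. ?s x * Gamma (?s x / 2 + cnj (\<beta> i))) \<longlongrightarrow> l) ?F" if i: "i \<in> {1..d}" for i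
  \<comment> \<open>As \<open>Re (\<beta> i) > - 1 / 2\<close>, a pole at 0 occurs only for
    \<open>\<beta> i = 0\<close>, and there
    \<open>x * Gamma (x / 2) = 2 * Gamma (x / 2 + 1)\<close>.\<close>
  proof (cases "\<beta> i = 0")
    case True
    have "((\<lambda>x. 2 * Gamma (?s x / 2 + 1)) \<longlongrightarrow> 2 * Gamma (0 / 2 + 1)) ?F"
      by (intro tendsto_intros s0) (auto elim!: nonpos_Ints_cases simp: complex_eq_iff)
    moreover have "eventually (\<lambda>x. 2 * Gamma (?s x / 2 + 1) = ?s x * Gamma (?s x / 2 + cnj (\<beta> i))) ?F"
      using reg[OF i]
    proof eventually_elim
      case (elim x)
      then show ?case using Gamma_plus1[of "?s x / 2"] True by (simp add: mult_ac)
    qed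
    ultimately have "((\<lambda>x. ?s x * Gamma (?s x / 2 + cnj (\<beta> i))) \<longlongrightarrow> 2 * Gamma (0 / 2 + 1)) ?F"
      by (rule Lim_transform_eventually)
    then show ?thesis by blast
  next
    case False
    have "cnj (\<beta> i) \<notin> \<int>\<^sub>\<le>\<^sub>0"
    proof
      assume "cnj (\<beta> i) \<in> \<int>\<^sub>\<le>\<^sub>0"
      then obtain n where n: "cnj (\<beta> i) = of_int n" "n \<le> 0" by (rule nonpos_Ints_cases)
      then have "Re (\<beta> i) = of_int n" by (simp add: complex_eq_iff)
      then have "real_of_int n > -1" using \<beta> i by force
      then show False using n False by (cases "n = 0") auto
    qed
    then have "((\<lambda>x. ?s x * Gamma (?s x / 2 + cnj (\<beta> i))) \<longlongrightarrow> 0 * Gamma (0 / 2 + cnj (\<beta> i))) ?F"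
      by (intro tendsto_intros s0) auto
    then show ?thesis by blast
  qed
  then obtain l where l: "\<And>i. i \<in> {1..d} \<Longrightarrow> ((\<lambda>x. ?s x * Gamma (?s x / 2 + cnj (\<beta> i))) \<longlongrightarrow> l i) ?F"
    by metis
  have L'0: "((\<lambda>x. L' (?s x)) \<longlongrightarrow> L' 0) ?F"
  proof -
    have "L' holomorphic_on - {1}" using cont(2) by (simp add: continuation_condition_def)
    then have "continuous_on (- {1}) L'" by (rule holomorphic_on_imp_continuous_on)
    moreover have "open (- {1::complex})" by auto
    ultimately have "isCont L' 0" by (simp add: continuous_on_eq_continuous_at)
    then show ?thesis using s0 by (rule isCont_tendsto_compose)
  qed
  have rG: "((\<lambda>x. rGamma ((1 - ?s x) / 2 + \<beta> i)) \<longlongrightarrow> rGamma ((1 - 0) / 2 + \<beta> i)) ?F" for i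
    by (intro tendsto_intros s0 continuous_on_tendsto_compose[OF continuous_on_rGamma[of UNIV]]) auto
  have Qp: "((\<lambda>x. Q powr (?s x - 1 / 2)) \<longlongrightarrow> Q powr (0 - 1 / 2)) ?F"
  proof -
    have "((\<lambda>x. exp ((?s x - 1 / 2) * Ln Q)) \<longlongrightarrow> exp ((0 - 1 / 2) * Ln Q)) ?F"
      by (intro tendsto_intros s0)
    then show ?thesis using Q by (simp add: powr_def)
  qed
  \<comment> \<open>Near 0, T is \<open>x ^ d * L (1 - x)\<close> with one x given to each Gamma
    factor, so it has a limit. The surplus power \<open>x ^ (m - d)\<close> then forces
    \<open>g 1 = 0\<close>.\<close>
  define T where "T = (\<lambda>x. \<omega> * Q powr (?s x - 1 / 2) *
      (\<Prod>i=1..d. ?s x * Gamma (?s x / 2 + cnj (\<beta> i)) * rGamma ((1 - ?s x) / 2 + \<beta> i)) * L' (?s x))"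
  have "(T \<longlongrightarrow> \<omega> * Q powr (0 - 1 / 2) * (\<Prod>i=1..d. l i * rGamma ((1 - 0) / 2 + \<beta> i)) * L' 0) ?F"
    unfolding T_def by (intro tendsto_mult tendsto_const Qp tendsto_prod l rG L'0)
  moreover have "((\<lambda>x. (-1) ^ m * ?s x ^ (m - d)) \<longlongrightarrow> (-1) ^ m * 0 ^ (m - d)) ?F"
    by (intro tendsto_intros s0)
  ultimately have "((\<lambda>x. (-1) ^ m * ?s x ^ (m - d) * T x) \<longlongrightarrow> (-1) ^ m * 0 ^ (m - d) *
     (\<omega> * Q powr (0 - 1 / 2) * (\<Prod>i=1..d. l i * rGamma ((1 - 0) / 2 + \<beta> i)) * L' 0)) ?F"
    by (rule tendsto_mult[rotated])
  then have lim0: "((\<lambda>x. (-1) ^ m * ?s x ^ (m - d) * T x) \<longlongrightarrow> 0) ?F"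
    using m by (simp add: power_0_left)
  have "eventually (\<lambda>x. \<forall>i\<in>{1..d}. (1 - ?s x) / 2 + \<beta> i \<notin> \<int>\<^sub>\<le>\<^sub>0 \<and> ?s x / 2 + cnj (\<beta> i) \<notin> \<int>\<^sub>\<le>\<^sub>0) ?F"
    using reg by (intro eventually_ball_finite) auto
  then have "eventually (\<lambda>x. (-1) ^ m * ?s x ^ (m - d) * T x = g (1 - ?s x)) ?F"
    using pos
  proof eventually_elim
    case (elim x)
    have "L (1 - ?s x) = \<omega> * Q powr (?s x - 1 / 2) *
      (\<Prod>i=1..d. Gamma (?s x / 2 + cnj (\<beta> i)) * rGamma ((1 - ?s x) / 2 + \<beta> i)) * L' (?s x)"
      by (rule functional_equation_solved[OF fe Q]) (use elim in auto)
    then have "?s x ^ d * L (1 - ?s x) = T x"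
      by (simp add: T_def prod.distrib mult_ac)
    moreover have "g (1 - ?s x) = (-1) ^ m * (?s x ^ (m - d) * ?s x ^ d) * L (1 - ?s x)"
      using elim m by (subst g(2)) (auto simp: power_minus[of "?s x"] simp flip: power_add)
    ultimately show ?case by (simp add: mult_ac)
  qed
  with lim0 have "((\<lambda>x. g (1 - ?s x)) \<longlongrightarrow> 0) ?F"
    by (rule Lim_transform_eventually)
  moreover have "((\<lambda>x. g (1 - ?s x)) \<longlongrightarrow> g (1 - 0)) ?F"
    by (intro continuous_on_tendsto_compose[OF holomorphic_on_imp_continuous_on[OF g(1)]] tendsto_intros s0) auto
  ultimately show False
    using g(3) tendsto_unique[of ?F] by (metis diff_zero trivial_limit_at_right_real)
qed

text \<open>On the line \<open>Re s = 3 / 2\<close>, up to conjugation, the arguments of the Gamma factors on the two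
  sides differ by exactly 1, so that no asymptotics of the Gamma function are needed.\<close>

lemma functional_equation_edge_regular:
  assumes fe: "functional_equation d Q \<beta> \<omega> L L'" and Q: "Q \<noteq> 0" and \<omega>: "norm \<omega> = 1"
    and d: "d \<ge> 1" and s: "Re s = 3 / 2" and reg: "\<And>i. i \<in> {1..d} \<Longrightarrow> Im s \<noteq> 2 * Im (\<beta> i)"
  shows "norm (L (1 - s)) \<le> conductor d Q \<beta> * exp (5 * real d * \<bar>Im s\<bar>) * norm (L' s)"
proof -
  have nonint: "z \<notin> \<int>\<^sub>\<le>\<^sub>0" if "Im z \<noteq> 0" for z :: complex
    using that by (auto elim!: nonpos_Ints_cases)
  have reg': "(1 - s) / 2 + \<beta> i \<notin> \<int>\<^sub>\<le>\<^sub>0 \<and> s / 2 + cnj (\<beta> i) \<notin> \<int>\<^sub>\<le>\<^sub>0" if "i \<in> {1..d}" for i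
    using reg[OF that] by (intro conjI nonint) auto
  have eq: "L (1 - s) = \<omega> * Q powr (s - 1 / 2) *
    (\<Prod>i=1..d. Gamma (s / 2 + cnj (\<beta> i)) * rGamma ((1 - s) / 2 + \<beta> i)) * L' s"
    by (rule functional_equation_solved[OF fe Q _ _ reg']) (use s in auto)
  have term_le: "norm (Gamma (s / 2 + cnj (\<beta> i)) * rGamma ((1 - s) / 2 + \<beta> i))
      \<le> (3 + norm (\<beta> i)) * exp \<bar>Im s\<bar>" if i: "i \<in> {1..d}" for i
  proof -
    define z where "z = s / 2 + cnj (\<beta> i)"
    have z: "z \<notin> \<int>\<^sub>\<le>\<^sub>0" using reg'[OF i] by (simp add: z_def)
    have "cnj ((1 - s) / 2 + \<beta> i) = z - 1" using s by (simp add: z_def complex_eq_iff)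
    then have "norm (rGamma ((1 - s) / 2 + \<beta> i)) = norm (rGamma (z - 1))"
      by (metis cnj_rGamma complex_mod_cnj)
    also have "rGamma (z - 1) = (z - 1) * rGamma z" using rGamma_plus1[of "z - 1"] by simp
    finally have "norm (Gamma z * rGamma ((1 - s) / 2 + \<beta> i)) = norm (z - 1)"
      using z by (simp add: norm_mult rGamma_inverse_Gamma norm_inverse Gamma_eq_zero_iff)
    also have "z - 1 = (s / 2 - 1) + cnj (\<beta> i)" by (simp add: z_def)
    also have "norm \<dots> \<le> norm (s / 2 - 1) + norm (\<beta> i)"
      using norm_triangle_ineq[of "s / 2 - 1" "cnj (\<beta> i)"] by simp
    also have "norm (s / 2 - 1) \<le> 1 / 4 + \<bar>Im s\<bar> / 2"
      using cmod_le[of "s / 2 - 1"] s by simp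
    also have "1 / 4 + \<bar>Im s\<bar> / 2 + norm (\<beta> i) \<le> (3 + norm (\<beta> i)) * (1 + \<bar>Im s\<bar>)"
    proof -
      have "(3 + norm (\<beta> i)) * (1 + \<bar>Im s\<bar>) = 3 + norm (\<beta> i) + 3 * \<bar>Im s\<bar> + \<bar>Im s\<bar> * norm (\<beta> i)"
        by (simp add: algebra_simps)
      moreover have "0 \<le> \<bar>Im s\<bar> * norm (\<beta> i)" by simp
      ultimately show ?thesis by linarith
    qed
    also have "\<dots> \<le> (3 + norm (\<beta> i)) * exp \<bar>Im s\<bar>"
      by (intro mult_left_mono exp_ge_add_one_self) auto
    finally show ?thesis by (simp add: z_def)
  qed
  have prod_le: "(\<Prod>i=1..d. norm (Gamma (s / 2 + cnj (\<beta> i)) * rGamma ((1 - s) / 2 + \<beta> i)))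
      \<le> (\<Prod>i=1..d. 3 + norm (\<beta> i)) * exp (real d * \<bar>Im s\<bar>)"
  proof -
    have "(\<Prod>i=1..d. norm (Gamma (s / 2 + cnj (\<beta> i)) * rGamma ((1 - s) / 2 + \<beta> i)))
      \<le> (\<Prod>i=1..d. (3 + norm (\<beta> i)) * exp \<bar>Im s\<bar>)"
      by (intro prod_mono conjI term_le norm_ge_zero)
    also have "\<dots> = (\<Prod>i=1..d. 3 + norm (\<beta> i)) * exp (real d * \<bar>Im s\<bar>)"
      by (simp add: prod.distrib exp_of_nat_mult)
    finally show ?thesis .
  qed
  have Q_le: "norm (Q powr (s - 1 / 2)) \<le> norm Q * exp (pi * \<bar>Im s\<bar>)"
    using norm_powr_le_exp_Im[of Q "s - 1 / 2"] s by simp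
  have "norm (L (1 - s)) \<le> (norm Q * exp (pi * \<bar>Im s\<bar>)) *
      ((\<Prod>i=1..d. 3 + norm (\<beta> i)) * exp (real d * \<bar>Im s\<bar>)) * norm (L' s)"
    unfolding eq norm_mult \<omega> prod_norm[symmetric] mult_1
    using Q_le prod_le by (intro mult_mono) (auto simp: norm_mult intro!: mult_nonneg_nonneg prod_nonneg)
  also have "\<dots> = (norm Q * (\<Prod>i=1..d. 3 + norm (\<beta> i))) * exp ((pi + real d) * \<bar>Im s\<bar>) * norm (L' s)"
    unfolding distrib_right exp_add by (simp add: mult_ac)
  also have "\<dots> \<le> conductor d Q \<beta> * exp (5 * real d * \<bar>Im s\<bar>) * norm (L' s)"
  proof -
    \<comment> \<open>The constant 5 comes from \<open>pi < 4\<close> and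
      \<open>d \<ge> 1\<close>.\<close>
    have "(pi + real d) * \<bar>Im s\<bar> \<le> 5 * real d * \<bar>Im s\<bar>"
      using pi_less_4 d by (intro mult_right_mono) auto
    moreover have "0 \<le> conductor d Q \<beta>" by (rule order.trans[OF _ conductor_bounds(1)]) simp
    ultimately show ?thesis
      using conductor_bounds(2)[of Q \<beta> d]
      by (intro mult_right_mono mult_mono) auto
  qed
  finally show ?thesis .
qed

text \<open>Both sides are continuous along the line, and
  \<open>functional_equation_edge_regular\<close> misses only finitely many ordinates, whose
  complement is dense.\<close>

lemma functional_equation_edge:
  assumes fe: "functional_equation d Q \<beta> \<omega> L L'" and Q: "Q \<noteq> 0" and \<omega>: "norm \<omega> = 1"
    and hol: "L holomorphic_on - {1}" "L' holomorphic_on - {1}"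
    and d: "d \<ge> 1" and s: "Re s = 3 / 2"
  shows "norm (L (1 - s)) \<le> conductor d Q \<beta> * exp (5 * real d * \<bar>Im s\<bar>) * norm (L' s)"
proof -
  define E where "E = (\<lambda>i. 2 * Im (\<beta> i)) ` {1..d}"
  define X where "X = {t. norm (L (1 - Complex (3/2) t)) \<le>
    conductor d Q \<beta> * exp (5 * real d * \<bar>t\<bar>) * norm (L' (Complex (3/2) t))}"
  have cont: "continuous_on (- {1}) L" "continuous_on (- {1}) L'"
    using hol by (auto intro: holomorphic_on_imp_continuous_on)
  have cC: "continuous_on UNIV (\<lambda>t. Complex (3/2) t)"
    unfolding complex_eq by (intro continuous_intros)
  have "closed X"
    unfolding X_def
  proof (rule closed_Collect_le)
    show "continuous_on UNIV (\<lambda>t. norm (L (1 - Complex (3/2) t)))"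
      by (intro continuous_on_norm continuous_on_compose2[OF cont(1)] continuous_intros cC)
        (auto simp: complex_eq_iff)
    show "continuous_on UNIV (\<lambda>t. conductor d Q \<beta> * exp (5 * real d * \<bar>t\<bar>) * norm (L' (Complex (3/2) t)))"
      by (intro continuous_intros continuous_on_compose2[OF cont(2)] cC)
        (auto simp: complex_eq_iff)
  qed
  moreover have "- E \<subseteq> X"
  proof
    fix t assume "t \<in> - E"
    then have "norm (L (1 - Complex (3/2) t)) \<le> conductor d Q \<beta> * exp (5 * real d * \<bar>Im (Complex (3/2) t)\<bar>) * norm (L' (Complex (3/2) t))"
      by (intro functional_equation_edge_regular[OF fe Q \<omega> d]) (auto simp: E_def)
    then show "t \<in> X" by (simp add: X_def)
  qed
  ultimately have "closure (- E) \<subseteq> X" by (rule closure_minimal[rotated])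
  moreover have "closure (- E) = UNIV"
    using empty_interior_finite[of E] by (simp add: closure_complement E_def)
  ultimately have "Im s \<in> X" by auto
  moreover have "Complex (3/2) (Im s) = s" using s by (simp add: complex_eq_iff)
  ultimately show ?thesis by (simp add: X_def)
qed

section \<open>Growth in vertical strips\<close>

lemma L_bounded_right:
  assumes "euler_product_condition d A L" "\<sigma> > 1"
  obtains Z where "Z \<ge> 0" "\<And>s. Re s \<ge> \<sigma> \<Longrightarrow> norm (L s) \<le> Z"
proof -
  obtain a :: "nat \<Rightarrow> complex" where a:
    "\<And>s. Re s > 1 \<Longrightarrow> (\<lambda>n. norm (a n * of_nat n powr (- s))) summable_on {1..}"
    "\<And>s. Re s > 1 \<Longrightarrow> ((\<lambda>n. a n * of_nat n powr (- s)) has_sum L s) {1..}"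
    using assms(1) unfolding euler_product_condition_def by metis
  define Z where "Z = (\<Sum>\<^sub>\<infinity>n\<in>{1..}. norm (a n * of_nat n powr (- of_real \<sigma>)))"
  have "norm (L s) \<le> Z" if s: "Re s \<ge> \<sigma>" for s
  proof -
    have s1: "Re s > 1" using s assms(2) by simp
    have "norm (L s) \<le> (\<Sum>\<^sub>\<infinity>n\<in>{1..}. norm (a n * of_nat n powr (- s)))"
      using norm_infsum_bound[OF a(1)[OF s1]] infsumI[OF a(2)[OF s1]] by simp
    also have "\<dots> \<le> Z"
      unfolding Z_def
    proof (rule infsum_mono[OF a(1)[OF s1] a(1)])
      fix n :: nat assume "n \<in> {1..}"
      then have n: "real n \<ge> 1" by simp
      have "norm ((of_nat n :: complex) powr (- s)) = real n powr (- Re s)"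
        using n norm_powr_real_powr[of "of_nat n" "- s"] by simp
      also have "\<dots> \<le> real n powr (- \<sigma>)" using n s by (intro powr_mono) auto
      also have "\<dots> = norm ((of_nat n :: complex) powr (- of_real \<sigma>))"
        using n norm_powr_real_powr[of "of_nat n" "- of_real \<sigma>"] by simp
      finally show "norm (a n * of_nat n powr (- s)) \<le> norm (a n * of_nat n powr (- of_real \<sigma>))"
        by (simp add: norm_mult mult_left_mono)
    qed (use assms(2) in auto)
    finally show ?thesis .
  qed
  moreover have "Z \<ge> 0" unfolding Z_def by (intro infsum_nonneg) auto
  ultimately show ?thesis using that by blast
qed

text \<open>Left of the strip of the growth condition, the functional equation leads back into the
  half-plane of absolute convergence; only the existence of some bound matters here.\<close>

lemma growth_left:
  assumes euler': "euler_product_condition d A' L'" and Q: "Q \<noteq> 0" and \<omega>: "norm \<omega> = 1"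
    and fe: "functional_equation d Q \<beta> \<omega> L L'" and \<delta>: "\<delta> > 0"
  obtains K T where "K \<ge> 0" "\<And>s. - 1 / 2 \<le> Re s \<Longrightarrow> Re s \<le> - \<delta> \<Longrightarrow> \<bar>Im s\<bar> \<ge> T \<Longrightarrow>
           norm (L s) \<le> K * exp (exp (\<bar>Im s\<bar> / 2))"
proof -
  obtain Z where Z: "Z \<ge> 0" "\<And>s. Re s \<ge> 1 + \<delta> \<Longrightarrow> norm (L' s) \<le> Z"
    using L_bounded_right[OF euler', of "1 + \<delta>"] \<delta> by auto
  \<comment> \<open>B exceeds every shift by 2: for \<open>\<bar>Im s\<bar> \<ge> 2 * B\<close> the
    Gamma arguments to be estimated satisfy \<open>\<bar>Re z\<bar> \<le> B\<close> and keep
    distance at least 1 from the real axis.\<close>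
  define B where "B = 2 + (\<Sum>i=1..d. norm (\<beta> i))"
  have B: "norm (\<beta> i) \<le> B - 2" if "i \<in> {1..d}" for i
    unfolding B_def using member_le_sum[of i "{1..d}" "\<lambda>i. norm (\<beta> i)"] that by auto
  obtain G where G: "G \<ge> 0" "\<And>z. - B \<le> Re z \<Longrightarrow> Re z \<le> B \<Longrightarrow> \<bar>Im z\<bar> \<ge> 1 \<Longrightarrow> norm (Gamma z) \<le> G"
    using Gamma_bounded_off_real_axis[of "- B" B] by metis
  have nonint: "z \<notin> \<int>\<^sub>\<le>\<^sub>0" if "\<bar>Im z\<bar> \<ge> 1" for z :: complex
    using that by (auto elim!: nonpos_Ints_cases)
  define K where "K = (1 + norm Q) * (G * G) ^ d * Z"
  have main: "norm (L s) \<le> K * exp ((pi + pi * real d) * \<bar>Im s\<bar>)"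
    if s: "- 1 / 2 \<le> Re s" "Re s \<le> - \<delta>" "\<bar>Im s\<bar> \<ge> 2 * B" for s
  proof -
    define s' where "s' = 1 - s"
    have Im_ge: "\<bar>Im s' / 2 - Im (\<beta> i)\<bar> \<ge> 1" "\<bar>Im s' / 2 - Im (\<beta> i)\<bar> \<le> \<bar>Im s\<bar>" if "i \<in> {1..d}" for i
      using B[OF that] abs_Im_le_cmod[of "\<beta> i"] s(3) by (auto simp: s'_def abs_if split: if_splits)
    have reg: "(1 - s') / 2 + \<beta> i \<notin> \<int>\<^sub>\<le>\<^sub>0 \<and> s' / 2 + cnj (\<beta> i) \<notin> \<int>\<^sub>\<le>\<^sub>0" if "i \<in> {1..d}" for i
      using Im_ge(1)[OF that] by (intro conjI nonint) (auto simp: abs_minus_commute)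
    have B0: "B \<ge> 2" unfolding B_def by (simp add: sum_nonneg)
    have "s' \<noteq> 0" "s' \<noteq> 1" using s B0 by (auto simp: s'_def)
    then have eq: "L (1 - s') = \<omega> * Q powr (s' - 1 / 2) *
      (\<Prod>i=1..d. Gamma (s' / 2 + cnj (\<beta> i)) * rGamma ((1 - s') / 2 + \<beta> i)) * L' s'"
      by (rule functional_equation_solved[OF fe Q]) (use reg in auto)
    have term_le: "norm (Gamma (s' / 2 + cnj (\<beta> i)) * rGamma ((1 - s') / 2 + \<beta> i))
        \<le> G * G * exp (pi * \<bar>Im s\<bar>)" if i: "i \<in> {1..d}" for i
    proof -
      have Re\<beta>: "\<bar>Re (\<beta> i)\<bar> \<le> B - 2" using B[OF i] abs_Re_le_cmod[of "\<beta> i"] by simp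
      define y where "y = (1 - s') / 2 + \<beta> i"
      have Imy: "\<bar>Im y\<bar> = \<bar>Im s' / 2 - Im (\<beta> i)\<bar>" by (simp add: y_def)
      have "norm (Gamma (1 - y)) \<le> G"
        using Re\<beta> s \<delta> Im_ge(1)[OF i] Imy by (intro G) (auto simp: y_def s'_def abs_le_iff)
      moreover have "exp (pi * \<bar>Im y\<bar>) \<le> exp (pi * \<bar>Im s\<bar>)"
        using Imy Im_ge(2)[OF i] by (simp add: mult_left_mono)
      ultimately have "exp (pi * \<bar>Im y\<bar>) * norm (Gamma (1 - y)) \<le> exp (pi * \<bar>Im s\<bar>) * G"
        by (intro mult_mono) auto
      then have 1: "norm (rGamma y) \<le> exp (pi * \<bar>Im s\<bar>) * G"
        using norm_inverse_Gamma_le[of y] Imy Im_ge(1)[OF i] by (simp add: rGamma_inverse_Gamma)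
      have "norm (Gamma (s' / 2 + cnj (\<beta> i))) \<le> G"
        using Re\<beta> s \<delta> Im_ge(1)[OF i] by (intro G) (auto simp: s'_def abs_le_iff field_simps)
      then have "norm (Gamma (s' / 2 + cnj (\<beta> i))) * norm (rGamma y) \<le> G * (exp (pi * \<bar>Im s\<bar>) * G)"
        using 1 G(1) by (intro mult_mono) auto
      then show ?thesis by (simp add: norm_mult y_def mult_ac)
    qed
    have "(\<Prod>i=1..d. norm (Gamma (s' / 2 + cnj (\<beta> i)) * rGamma ((1 - s') / 2 + \<beta> i)))
        \<le> (\<Prod>i=1..d. G * G * exp (pi * \<bar>Im s\<bar>))"
      by (intro prod_mono conjI term_le norm_ge_zero)
    also have "\<dots> = (G * G) ^ d * exp (pi * real d * \<bar>Im s\<bar>)"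
      by (simp add: power_mult_distrib mult_ac flip: exp_of_nat_mult)
    finally have prod_le: "(\<Prod>i=1..d. norm (Gamma (s' / 2 + cnj (\<beta> i)) * rGamma ((1 - s') / 2 + \<beta> i)))
        \<le> (G * G) ^ d * exp (pi * real d * \<bar>Im s\<bar>)" .
    have "norm (Q powr (s' - 1 / 2)) \<le> norm Q powr (Re s' - 1 / 2) * exp (pi * \<bar>Im s\<bar>)"
      using norm_powr_le_exp_Im[of Q "s' - 1 / 2"] by (simp add: s'_def)
    also have "norm Q powr (Re s' - 1 / 2) \<le> (1 + norm Q) powr (Re s' - 1 / 2)"
      using s \<delta> by (intro powr_mono2) (auto simp: s'_def)
    also have "\<dots> \<le> (1 + norm Q) powr 1"
      using s by (intro powr_mono) (auto simp: s'_def)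
    finally have Q_le: "norm (Q powr (s' - 1 / 2)) \<le> (1 + norm Q) * exp (pi * \<bar>Im s\<bar>)"
      by simp
    have "norm (L' s') \<le> Z" using s by (intro Z) (auto simp: s'_def)
    then have "norm (L (1 - s')) \<le> ((1 + norm Q) * exp (pi * \<bar>Im s\<bar>)) *
        ((G * G) ^ d * exp (pi * real d * \<bar>Im s\<bar>)) * Z"
      unfolding eq norm_mult \<omega> prod_norm[symmetric] mult_1
      using Q_le prod_le G(1) by (intro mult_mono) (auto simp: norm_mult intro!: prod_nonneg)
    moreover have "exp ((pi + pi * real d) * \<bar>Im s\<bar>) = exp (pi * \<bar>Im s\<bar>) * exp (pi * real d * \<bar>Im s\<bar>)"
      by (simp add: distrib_right flip: exp_add)
    ultimately show ?thesis by (simp add: s'_def K_def mult_ac)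
  qed
  have "eventually (\<lambda>y. c * y \<le> exp (y / 2)) at_top" if "c > 0" for c :: real
    using that by real_asymp
  from this[of "pi + pi * real d"] have "eventually (\<lambda>y. (pi + pi * real d) * y \<le> exp (y / 2)) at_top"
    by (simp add: add_pos_nonneg)
  then obtain T where T: "\<And>y. y \<ge> T \<Longrightarrow> (pi + pi * real d) * y \<le> exp (y / 2)"
    by (auto simp: eventually_at_top_linorder)
  show ?thesis
  proof (rule that[of K "max T (2 * B)"])
    show K0: "K \<ge> 0" unfolding K_def using G Z by (intro mult_nonneg_nonneg) auto
    show "norm (L s) \<le> K * exp (exp (\<bar>Im s\<bar> / 2))"
      if "- 1 / 2 \<le> Re s" "Re s \<le> - \<delta>" "\<bar>Im s\<bar> \<ge> max T (2 * B)" for s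
    proof -
      have "norm (L s) \<le> K * exp ((pi + pi * real d) * \<bar>Im s\<bar>)" using that by (intro main) auto
      also have "\<dots> \<le> K * exp (exp (\<bar>Im s\<bar> / 2))"
        using T[of "\<bar>Im s\<bar>"] that K0 by (intro mult_left_mono) auto
      finally show ?thesis .
    qed
  qed
qed

text \<open>Three overlapping ranges: the functional equation up to \<open>- \<delta> / 2\<close>,
  the growth condition in the middle, and absolute convergence from \<open>1 + \<delta> / 2\<close>
  on. This is the a priori growth for the strip that begins at
  \<open>Re s = - 1 / 2\<close>.\<close>

lemma growth_in_wide_strip:
  assumes euler: "euler_product_condition d A L" "euler_product_condition d A' L'"
    and Q: "Q \<noteq> 0" and \<omega>: "norm \<omega> = 1"
    and fe: "functional_equation d Q \<beta> \<omega> L L'" and growth: "growth_condition L"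
  obtains K T where "K \<ge> 0" "\<And>s. - 1 / 2 \<le> Re s \<Longrightarrow> \<bar>Im s\<bar> \<ge> T \<Longrightarrow>
           norm (L s) \<le> K * exp (exp (\<bar>Im s\<bar> / 2))"
proof -
  obtain \<delta> where \<delta>: "\<delta> > 0" and growth': "\<forall>\<epsilon>>0. \<exists>K T. \<forall>s. - \<delta> < Re s \<and> Re s < 1 + \<delta> \<and> \<bar>Im s\<bar> \<ge> T \<longrightarrow>
      norm (L s) \<le> K * exp (exp (\<epsilon> * \<bar>Im s\<bar>))"
    using growth unfolding growth_condition_def by blast
  from growth'[rule_format, of "1 / 2"] obtain K1 T1 where 1: "\<And>s. - \<delta> < Re s \<Longrightarrow> Re s < 1 + \<delta> \<Longrightarrow> \<bar>Im s\<bar> \<ge> T1 \<Longrightarrow>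
      norm (L s) \<le> K1 * exp (exp (1 / 2 * \<bar>Im s\<bar>))"
    by auto
  obtain Z where Z: "Z \<ge> 0" "\<And>s. Re s \<ge> 1 + \<delta> / 2 \<Longrightarrow> norm (L s) \<le> Z"
    using L_bounded_right[OF euler(1), of "1 + \<delta> / 2"] \<delta> by auto
  obtain K3 T3 where 3: "K3 \<ge> 0" "\<And>s. - 1 / 2 \<le> Re s \<Longrightarrow> Re s \<le> - (\<delta> / 2) \<Longrightarrow> \<bar>Im s\<bar> \<ge> T3 \<Longrightarrow>
           norm (L s) \<le> K3 * exp (exp (\<bar>Im s\<bar> / 2))"
    using growth_left[OF euler(2) Q \<omega> fe, of "\<delta> / 2"] \<delta> by auto
  show ?thesis
  proof (rule that[of "\<bar>K1\<bar> + Z + K3" "max T1 T3"])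
    show "norm (L s) \<le> (\<bar>K1\<bar> + Z + K3) * exp (exp (\<bar>Im s\<bar> / 2))"
      if s: "- 1 / 2 \<le> Re s" "\<bar>Im s\<bar> \<ge> max T1 T3" for s
    proof -
      define E where "E = exp (exp (\<bar>Im s\<bar> / 2))"
      have E: "E \<ge> 1" by (simp add: E_def)
      have nn: "\<bar>K1\<bar> * E \<ge> 0" "Z * E \<ge> 0" "K3 * E \<ge> 0" using Z 3 E by auto
      consider "Re s \<le> - (\<delta> / 2)" | "- \<delta> < Re s" "Re s < 1 + \<delta>" | "Re s \<ge> 1 + \<delta> / 2"
        using \<delta> by linarith
      then have "norm (L s) \<le> \<bar>K1\<bar> * E + Z * E + K3 * E"
      proof cases
        case 1
        then have "norm (L s) \<le> K3 * E" using 3(2)[of s] s by (simp add: E_def)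
        then show ?thesis using nn by linarith
      next
        case 2
        then have "norm (L s) \<le> K1 * E" using 1[of s] s by (simp add: E_def)
        also have "\<dots> \<le> \<bar>K1\<bar> * E" using E by (intro mult_right_mono) auto
        finally show ?thesis using nn by linarith
      next
        case 3
        have "norm (L s) \<le> Z * 1" using Z(2)[OF 3] by simp
        also have "\<dots> \<le> Z * E" using Z E by (intro mult_left_mono) auto
        finally show ?thesis using nn by linarith
      qed
      then show ?thesis by (simp add: E_def distrib_right)
    qed
  qed (use Z 3 in auto)
qed

section \<open>The bootstrap\<close>

text \<open>Three lines theorem on \<open>- 1 / 2 \<le> Re s \<le> 1 + 2 * w\<close>. The growth in \<open>\<bar>Im s\<bar>\<close> on the boundary
  is absorbed by the Gaussian factor in \<open>F\<close>, centred at \<open>s1\<close>; this costs only \<open>O((K + 1) d)\<close>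
  in the exponent. The factor \<open>((s - 1) / (s + 2)) ^ m\<close> removes the pole and is at most 1.\<close>

lemma edge_bound_step:
  fixes d m :: nat and g :: "complex \<Rightarrow> complex" and w K H :: real
  assumes euler: "euler_product_condition d A L" "euler_product_condition d A' L'"
    and Q: "Q \<noteq> 0" and \<omega>: "norm \<omega> = 1"
    and fe: "functional_equation d Q \<beta> \<omega> L L'" and growth: "growth_condition L"
    and hol: "L holomorphic_on - {1}" "L' holomorphic_on - {1}"
    and d: "d \<ge> 1"
    and g: "g holomorphic_on UNIV" "\<And>s. s \<noteq> 1 \<Longrightarrow> g s = (s - 1) ^ m * L s"
    and w: "0 < w" "w \<le> 1 / 8" and K: "K \<ge> 0"
    and H: "88 * real d \<le> H" "w * ln (conductor d Q \<beta>) \<le> 168 * H"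
    and bound: "\<And>s. Re s \<ge> 1 + 2 * w \<Longrightarrow> norm (L s) \<le> exp (K / 2 * (H + real d * \<bar>Im s\<bar>) + 2 * H)"
      "\<And>s. Re s \<ge> 1 + 2 * w \<Longrightarrow> norm (L' s) \<le> exp (K / 2 * (H + real d * \<bar>Im s\<bar>) + 2 * H)"
    and s1: "1 \<le> Re s1" "Re s1 \<le> 1 + 2 * w"
  shows "norm (g s1) \<le> norm (s1 + 2) ^ m * exp ((5 / 8 * K + 400) * (H + real d * \<bar>Im s1\<bar>))"
proof -
  define b where "b = 1 + 2 * w"
  \<comment> \<open>c is the width of the strip.\<close>
  define c where "c = b + 1 / 2"
  \<comment> \<open>On both edges the exponent grows in \<open>\<bar>Im s\<bar>\<close> with slope
    at most \<open>5 * \<gamma>\<close>, so the Gaussian with coefficient \<gamma> absorbs it (see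
    \<open>hump\<close>).\<close>
  define \<gamma> where "\<gamma> = (K + 1) * real d"
  define C where "C = conductor d Q \<beta>"
  \<comment> \<open>M is the excess of the exponent on the left edge over the right one, taken at
    the ordinate of \<open>s1\<close>. The last factor of F has modulus 1 on the right edge and
    \<open>exp (- M)\<close> on the left.\<close>
  define M where "M = ln C + 5 * real d * \<bar>Im s1\<bar>"
  define A0 where "A0 = K / 2 * H + 2 * H"
  define B0 where "B0 = K / 2 * real d"
  \<comment> \<open>\<open>11 * \<gamma>\<close> covers \<open>4 * \<gamma>\<close> from
    \<open>Re_sq\<close> and \<open>25 / 4 * \<gamma>\<close> from \<open>hump\<close>.\<close>
  define R where "R = A0 + B0 * \<bar>Im s1\<bar> + 11 * \<gamma>"
  define F where "F = (\<lambda>s. g s / (s + 2) ^ m * exp (of_real \<gamma> * (s - s1)\<^sup>2)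
      * exp (- (of_real M * (of_real b - s) / of_real c)))"
  have C: "C \<ge> 1"
    unfolding C_def by (rule order.trans[OF one_le_power conductor_bounds(1)]) simp
  then have M: "M \<ge> 0" by (simp add: M_def)
  have \<gamma>: "\<gamma> \<ge> 0" "\<gamma> = K * real d + real d" using K by (auto simp: \<gamma>_def algebra_simps)
  have Kd: "K * real d \<ge> 0" using K by simp
  have bound': "norm (L s) \<le> exp (A0 + B0 * \<bar>Im s\<bar>)" "norm (L' s) \<le> exp (A0 + B0 * \<bar>Im s\<bar>)"
    if "Re s \<ge> b" for s
    using bound[of s] that by (simp_all add: A0_def B0_def b_def c_def algebra_simps)
  have norm1: "norm (g s / (s + 2) ^ m) \<le> norm (L s)" if "Re s \<ge> - 1 / 2" "s \<noteq> 1" for s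
  proof -
    \<comment> \<open>The points 1 and -2 are mirror images in the line
      \<open>Re s = - 1 / 2\<close>.\<close>
    have "(norm (s - 1))\<^sup>2 \<le> (norm (s + 2))\<^sup>2"
      unfolding cmod_power2 using that by (simp add: power2_eq_square algebra_simps)
    then have le: "norm (s - 1) \<le> norm (s + 2)" by (rule power2_le_imp_le) simp
    have "Re (s + 2) \<noteq> 0" using that by simp
    then have nz: "s + 2 \<noteq> 0" by (metis zero_complex.sel(1))
    have "norm (g s / (s + 2) ^ m) = (norm (s - 1) / norm (s + 2)) ^ m * norm (L s)"
      using g(2)[OF that(2)] by (simp add: norm_mult norm_divide norm_power power_divide)
    also have "\<dots> \<le> 1 * norm (L s)"
      using le nz by (intro mult_right_mono power_le_one) auto
    finally show ?thesis by simp
  qed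
  have norm2: "norm (exp (of_real \<gamma> * (s - s1)\<^sup>2)) = exp (\<gamma> * ((Re s - Re s1)\<^sup>2 - (Im s - Im s1)\<^sup>2))" for s
    by (simp add: power2_eq_square algebra_simps)
  have norm3: "norm (exp (- (of_real M * (of_real b - s) / of_real c))) = exp (- (M * (b - Re s) / c))" for s
    by (simp add: Re_divide_of_real)
  have hump: "5 * \<gamma> * y - \<gamma> * y\<^sup>2 \<le> 25 / 4 * \<gamma>" for y :: real
  proof -
    have "0 \<le> \<gamma> * (y - 5 / 2)\<^sup>2" using \<gamma> by simp
    then show ?thesis by (simp add: power2_eq_square algebra_simps)
  qed
  have Im_shift: "k * \<bar>Im s\<bar> \<le> k * \<bar>Im s1\<bar> + 5 * \<gamma> * \<bar>Im s - Im s1\<bar>" if "0 \<le> k" "k \<le> 5 * \<gamma>" for k s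
  proof -
    have "k * \<bar>Im s\<bar> \<le> k * (\<bar>Im s1\<bar> + \<bar>Im s - Im s1\<bar>)" using that by (intro mult_left_mono) auto
    also have "\<dots> \<le> k * \<bar>Im s1\<bar> + 5 * \<gamma> * \<bar>Im s - Im s1\<bar>"
      using that by (simp add: distrib_left mult_right_mono)
    finally show ?thesis .
  qed
  have B0: "0 \<le> B0" "B0 + 5 * real d \<le> 5 * \<gamma>"
    using Kd by (auto simp: B0_def \<gamma>)
  have Re_sq: "(Re s - Re s1)\<^sup>2 \<le> 4" if "- 1 / 2 \<le> Re s" "Re s \<le> b" for s
  proof -
    have "\<bar>Re s - Re s1\<bar> \<le> 2" using that s1 w by (auto simp: b_def c_def abs_le_iff)
    then have "\<bar>Re s - Re s1\<bar>\<^sup>2 \<le> 2\<^sup>2" by (intro power_mono) auto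
    then show ?thesis by simp
  qed
  obtain K1 T where T: "K1 \<ge> 0" "\<And>s. - 1 / 2 \<le> Re s \<Longrightarrow> \<bar>Im s\<bar> \<ge> T \<Longrightarrow>
           norm (L s) \<le> K1 * exp (exp (\<bar>Im s\<bar> / 2))"
    using growth_in_wide_strip[OF euler Q \<omega> fe growth] by metis
  have "c > 0" using w by (simp add: b_def c_def)
  have nz2: "s + 2 \<noteq> 0" if "Re s > - 2" for s
    using that by (auto simp: complex_eq_iff)
  have holF: "F holomorphic_on {s. Re s > - 2}"
    unfolding F_def
    by (intro holomorphic_intros holomorphic_on_subset[OF g(1)]) (use nz2 \<open>c > 0\<close> in auto)
  have "norm (F s1) \<le> exp R"
  proof (rule phragmen_lindelof_strip[where F = F and a = "- 1 / 2" and b = b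
        and T = "max T 1" and K = "K1 * exp (4 * \<gamma>)"])
    show "- 1 / 2 < b" "b - - 1 / 2 \<le> 2" using w by (auto simp: b_def c_def)
    show "F holomorphic_on {s. - 1 / 2 < Re s \<and> Re s < b}"
      by (rule holomorphic_on_subset[OF holF]) auto
    show "continuous_on {s. - 1 / 2 \<le> Re s \<and> Re s \<le> b} F"
      by (rule continuous_on_subset[OF holomorphic_on_imp_continuous_on[OF holF]]) auto
    show "- 1 / 2 \<le> Re s1" "Re s1 \<le> b" using s1 by (auto simp: b_def c_def)
    show "norm (F s) \<le> (K1 * exp (4 * \<gamma>)) * exp (exp (\<bar>Im s\<bar> / 2))"
      if s: "- 1 / 2 \<le> Re s" "Re s \<le> b" "\<bar>Im s\<bar> \<ge> max T 1" for s
    proof -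
      have "s \<noteq> 1" using s(3) by auto
      then have 1: "norm (g s / (s + 2) ^ m) \<le> K1 * exp (exp (\<bar>Im s\<bar> / 2))"
        using norm1[of s] T(2)[of s] s by auto
      have "\<gamma> * ((Re s - Re s1)\<^sup>2 - (Im s - Im s1)\<^sup>2) \<le> \<gamma> * 4"
        using Re_sq[OF s(1,2)] \<gamma>(1) zero_le_power2[of "Im s - Im s1"] by (intro mult_left_mono) linarith+
      then have 2: "norm (exp (of_real \<gamma> * (s - s1)\<^sup>2)) \<le> exp (4 * \<gamma>)"
        unfolding norm2 by simp
      have 3: "norm (exp (- (of_real M * (of_real b - s) / of_real c))) \<le> 1"
        unfolding norm3 using M s w by (simp add: b_def c_def)
      have "norm (F s) \<le> K1 * exp (exp (\<bar>Im s\<bar> / 2)) * exp (4 * \<gamma>) * 1"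
        unfolding F_def norm_mult using T(1) by (intro mult_mono 1 2 3) auto
      then show ?thesis by (simp add: mult_ac)
    qed
    show "norm (F s) \<le> exp R" if "Re s = - 1 / 2 \<or> Re s = b" for s
      using that
    proof
      assume s: "Re s = b"
      define y where "y = \<bar>Im s - Im s1\<bar>"
      have "s \<noteq> 1" using s w by (auto simp: b_def c_def)
      then have 1: "norm (g s / (s + 2) ^ m) \<le> exp (A0 + B0 * \<bar>Im s\<bar>)"
        using norm1[of s] bound'(1)[of s] s w by (auto simp: b_def c_def)
      have "\<gamma> * (Re s - Re s1)\<^sup>2 \<le> \<gamma> * 4"
        using Re_sq[of s] s w \<gamma>(1) by (intro mult_left_mono) (auto simp: b_def c_def)
      moreover have "B0 * \<bar>Im s\<bar> \<le> B0 * \<bar>Im s1\<bar> + 5 * \<gamma> * y"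
        unfolding y_def using B0 by (intro Im_shift) auto
      ultimately have le: "A0 + B0 * \<bar>Im s\<bar> + \<gamma> * ((Re s - Re s1)\<^sup>2 - (Im s - Im s1)\<^sup>2) \<le> R"
        using hump[of y] \<gamma>(1) by (simp add: R_def y_def right_diff_distrib)
      have "norm (F s) = norm (g s / (s + 2) ^ m) * exp (\<gamma> * ((Re s - Re s1)\<^sup>2 - (Im s - Im s1)\<^sup>2))"
        unfolding F_def norm_mult norm2 norm3 using s by simp
      also have "\<dots> \<le> exp (A0 + B0 * \<bar>Im s\<bar>) * exp (\<gamma> * ((Re s - Re s1)\<^sup>2 - (Im s - Im s1)\<^sup>2))"
        using 1 by (intro mult_right_mono) auto
      also have "\<dots> \<le> exp R" using le by (simp flip: exp_add)
      finally show ?thesis .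
    next
      assume s: "Re s = - 1 / 2"
      define y where "y = \<bar>Im s - Im s1\<bar>"
      have "s \<noteq> 1" using s by auto
      have "norm (L (1 - (1 - s))) \<le> C * exp (5 * real d * \<bar>Im (1 - s)\<bar>) * norm (L' (1 - s))"
        unfolding C_def by (rule functional_equation_edge[OF fe Q \<omega> hol d]) (use s in auto)
      also have "\<dots> \<le> exp (ln C) * exp (5 * real d * \<bar>Im (1 - s)\<bar>) * exp (A0 + B0 * \<bar>Im (1 - s)\<bar>)"
        using bound'(2)[of "1 - s"] s w C by (intro mult_mono) (auto simp: b_def c_def)
      finally have "norm (L s) \<le> exp (ln C + 5 * real d * \<bar>Im s\<bar> + (A0 + B0 * \<bar>Im s\<bar>))"
        by (simp add: exp_add)
      then have 1: "norm (g s / (s + 2) ^ m) \<le> exp (ln C + A0 + (B0 + 5 * real d) * \<bar>Im s\<bar>)"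
        using norm1[of s] \<open>s \<noteq> 1\<close> s by (simp add: algebra_simps)
      have "\<gamma> * (Re s - Re s1)\<^sup>2 \<le> \<gamma> * 4"
        using Re_sq[of s] s w \<gamma>(1) by (intro mult_left_mono) (auto simp: b_def c_def)
      moreover have "(B0 + 5 * real d) * \<bar>Im s\<bar> \<le> (B0 + 5 * real d) * \<bar>Im s1\<bar> + 5 * \<gamma> * y"
        unfolding y_def using B0 by (intro Im_shift) auto
      ultimately have le: "ln C + A0 + (B0 + 5 * real d) * \<bar>Im s\<bar> +
          \<gamma> * ((Re s - Re s1)\<^sup>2 - (Im s - Im s1)\<^sup>2) - M \<le> R"
        using hump[of y] \<gamma>(1) by (simp add: R_def M_def y_def right_diff_distrib distrib_right)
      have "norm (F s) = norm (g s / (s + 2) ^ m) * exp (\<gamma> * ((Re s - Re s1)\<^sup>2 - (Im s - Im s1)\<^sup>2)) * exp (- M)"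
        unfolding F_def norm_mult norm2 norm3 using s w by (simp add: b_def c_def)
      also have "\<dots> \<le> exp (ln C + A0 + (B0 + 5 * real d) * \<bar>Im s\<bar>)
          * exp (\<gamma> * ((Re s - Re s1)\<^sup>2 - (Im s - Im s1)\<^sup>2)) * exp (- M)"
        using 1 by (intro mult_right_mono) auto
      also have "\<dots> \<le> exp R" using le by (simp flip: exp_add)
      finally show ?thesis .
    qed
  qed simp
  moreover have "norm (F s1) = norm (g s1) / norm (s1 + 2) ^ m * exp (- (M * (b - Re s1) / c))"
    unfolding F_def norm_mult norm2 norm3 by (simp add: norm_divide norm_power)
  moreover have "s1 + 2 \<noteq> 0" using s1 by (auto simp: complex_eq_iff)
  ultimately have "norm (g s1) \<le> norm (s1 + 2) ^ m * (exp R * exp (M * (b - Re s1) / c))"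
    by (simp add: exp_minus field_simps)
  \<comment> \<open>Since \<open>s1\<close> is within \<open>2 * w\<close> of the right edge and
    \<open>c \<ge> 1\<close>, interpolation costs at most \<open>2 * w * M\<close>. The Gaussian
    adds \<open>11 * K * d \<le> K * H / 8\<close>, and
    \<open>1 / 2 + 1 / 8 = 5 / 8\<close>.\<close>
  also have "exp R * exp (M * (b - Re s1) / c) \<le> exp ((5 / 8 * K + 400) * (H + real d * \<bar>Im s1\<bar>))"
  proof -
    have "(b - Re s1) / c \<le> (2 * w) / 1"
      using s1 w by (intro frac_le) (auto simp: b_def c_def)
    from mult_left_mono[OF this M] have "M * (b - Re s1) / c \<le> 2 * (w * M)"
      by (simp add: mult_ac)
    also have "w * M = w * ln C + w * (5 * real d * \<bar>Im s1\<bar>)" by (simp add: M_def distrib_left)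
    also have "\<dots> \<le> 168 * H + 1 / 8 * (5 * real d * \<bar>Im s1\<bar>)"
      using H(2) w by (intro add_mono mult_right_mono) (auto simp: C_def)
    finally have e1: "M * (b - Re s1) / c \<le> 336 * H + 5 / 4 * (real d * \<bar>Im s1\<bar>)" by simp
    have e2: "11 * (K * real d) \<le> K * H / 8"
      using mult_left_mono[OF H(1) K] by simp
    have "R = K * H / 2 + 2 * H + K * (real d * \<bar>Im s1\<bar>) / 2 + 11 * (K * real d) + 11 * real d"
      by (simp add: R_def A0_def B0_def \<gamma>)
    moreover have "(5 / 8 * K + 400) * (H + real d * \<bar>Im s1\<bar>) =
        5 / 8 * (K * H) + 5 / 8 * (K * (real d * \<bar>Im s1\<bar>)) + 400 * H + 400 * (real d * \<bar>Im s1\<bar>)"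
      by (simp add: algebra_simps)
    moreover have "0 \<le> K * (real d * \<bar>Im s1\<bar>)" "0 \<le> real d * \<bar>Im s1\<bar>" "0 \<le> real d" using K by auto
    ultimately have "R + M * (b - Re s1) / c \<le> (5 / 8 * K + 400) * (H + real d * \<bar>Im s1\<bar>)"
      using e1 e2 H(1) by linarith
    then show ?thesis by (simp flip: exp_add)
  qed
  finally show ?thesis by (simp add: mult_left_mono)
qed

text \<open>This is \<open>L_function\<close> with its existential quantifiers opened. The bundle is
  symmetric in L and L' (\<open>dual_pair_sym\<close>), so each step proved for L serves both
  functions.\<close>

definition dual_pair ::
  "nat \<Rightarrow> complex \<Rightarrow> (nat \<Rightarrow> complex) \<Rightarrow> complex \<Rightarrow>
   (nat \<Rightarrow> complex mat) \<Rightarrow> nat \<Rightarrow> (complex \<Rightarrow> complex) \<Rightarrow>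
   (nat \<Rightarrow> complex mat) \<Rightarrow> nat \<Rightarrow> (complex \<Rightarrow> complex) \<Rightarrow> bool" where
  "dual_pair d Q \<beta> \<omega> A m L A' m' L' \<longleftrightarrow>
     euler_product_condition d A L \<and> continuation_condition m L \<and> growth_condition L \<and>
     euler_product_condition d A' L' \<and> continuation_condition m' L' \<and> growth_condition L' \<and>
     Q \<noteq> 0 \<and> (\<forall>i\<in>{1..d}. Re (\<beta> i) > - 1 / 2) \<and> norm \<omega> = 1 \<and> functional_equation d Q \<beta> \<omega> L L'"

lemma L_function_iff_dual_pair:
  "L_function d A m Q \<beta> L \<longleftrightarrow> (\<exists>\<omega> A' m' L'. dual_pair d Q \<beta> \<omega> A m L A' m' L')"
  unfolding L_function_def dual_pair_def by blast

lemma dual_pair_sym: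
  assumes "dual_pair d Q \<beta> \<omega> A m L A' m' L'"
  shows "dual_pair d Q (\<lambda>i. cnj (\<beta> i)) (inverse \<omega>) A' m' L' A m L"
  using assms functional_equation_sym[of d Q \<beta> \<omega> L L']
  by (auto simp: dual_pair_def norm_inverse)

lemma conductor_cnj: "conductor d Q (\<lambda>i. cnj (\<beta> i)) = conductor d Q \<beta>"
  by (simp add: conductor_def)

text \<open>\<open>euler_product_log_bound_step\<close> for both functions feeds
  \<open>edge_bound_step\<close>. The second conclusion has the form of \<open>bound\<close> with
  \<open>5 / 8 * K + 401\<close> in place of K and can be iterated; the first reaches the line
  \<open>Re s = 1\<close>.\<close>

lemma bootstrap_step:
  fixes d m m' :: nat and w K H \<Delta> :: real
  assumes pair: "dual_pair d Q \<beta> \<omega> A m L A' m' L'" and d: "d \<ge> 1"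
    and \<Delta>: "\<Delta> \<ge> 1344" "real d \<le> exp (2 * \<Delta>)" and w: "w = 168 / \<Delta>" and K: "K \<ge> 0"
    and H: "H \<ge> real d * \<Delta> * exp \<Delta>" "H \<ge> ln (conductor d Q \<beta>) / \<Delta>"
    and bound: "\<And>s. Re s \<ge> 1 + w \<Longrightarrow> norm (L s) \<le> exp (K * (H + real d * \<bar>Im s\<bar>))"
      "\<And>s. Re s \<ge> 1 + w \<Longrightarrow> norm (L' s) \<le> exp (K * (H + real d * \<bar>Im s\<bar>))"
  shows "\<lbrakk>g holomorphic_on UNIV; \<And>s. s \<noteq> 1 \<Longrightarrow> g s = (s - 1) ^ m * L s; 1 \<le> Re s; Re s \<le> 1 + 2 * w\<rbrakk> \<Longrightarrow>
      norm (g s) \<le> norm (s + 2) ^ m * exp ((5 / 8 * K + 400) * (H + real d * \<bar>Im s\<bar>))"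
    and "Re s \<ge> 1 + w \<Longrightarrow> norm (L s) \<le> exp ((5 / 8 * K + 401) * (H + real d * \<bar>Im s\<bar>))"
proof -
  have euler: "euler_product_condition d A L" "euler_product_condition d A' L'"
    and cont: "continuation_condition m L" "continuation_condition m' L'"
    and growth: "growth_condition L" and Q: "Q \<noteq> 0" and \<omega>: "norm \<omega> = 1"
    and fe: "functional_equation d Q \<beta> \<omega> L L'"
    and \<beta>: "\<forall>i\<in>{1..d}. Re (\<beta> i) > - 1 / 2"
    using pair by (auto simp: dual_pair_def)
  have hol: "L holomorphic_on - {1}" "L' holomorphic_on - {1}"
    using cont by (auto simp: continuation_condition_def)
  then have hol1: "L holomorphic_on {s. Re s > 1}" "L' holomorphic_on {s. Re s > 1}"
    by (auto intro: holomorphic_on_subset)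
  have m: "m \<le> d" using pole_order_le_degree[OF cont \<beta> Q fe] .
  have wpos: "0 < w" "w \<le> 1/8" using \<Delta> by (auto simp: w field_simps)
  have d1: "real d \<ge> 1" using d by simp
  have e1: "exp \<Delta> \<ge> 1" using \<Delta> by simp
  have "real d * \<Delta> * 1 \<le> real d * \<Delta> * exp \<Delta>" using \<Delta> e1 by (intro mult_left_mono) auto
  then have H\<Delta>: "real d * \<Delta> \<le> H" using H(1) by simp
  have "real d * 1344 \<le> real d * \<Delta>" using \<Delta> by (intro mult_left_mono) auto
  then have Hd: "1344 * real d \<le> H" using H\<Delta> by simp
  then have H1: "H \<ge> 1" using d1 by linarith
  have Hw: "w * ln (conductor d Q \<beta>) \<le> 168 * H" using H(2) by (simp add: w)
  have far: "norm (L s) \<le> exp (K / 2 * (H + real d * \<bar>Im s\<bar>) + 2 * H)"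
    "norm (L' s) \<le> exp (K / 2 * (H + real d * \<bar>Im s\<bar>) + 2 * H)" if "Re s \<ge> 1 + 2 * w" for s
    using euler_product_log_bound_step[OF euler(1) hol1(1) \<Delta> w H(1) H1 K bound(1) that]
      euler_product_log_bound_step[OF euler(2) hol1(2) \<Delta> w H(1) H1 K bound(2) that] by auto
  have near: "norm (g s) \<le> norm (s + 2) ^ m * exp ((5 / 8 * K + 400) * (H + real d * \<bar>Im s\<bar>))"
    if "g holomorphic_on UNIV" "\<And>s. s \<noteq> 1 \<Longrightarrow> g s = (s - 1) ^ m * L s" "1 \<le> Re s" "Re s \<le> 1 + 2 * w" for g s
    by (rule edge_bound_step[OF euler Q \<omega> fe growth hol d that(1,2) wpos K _ Hw far that(3,4)])
      (use Hd in auto)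
  show "norm (g s) \<le> norm (s + 2) ^ m * exp ((5 / 8 * K + 400) * (H + real d * \<bar>Im s\<bar>))"
    if "g holomorphic_on UNIV" "\<And>s. s \<noteq> 1 \<Longrightarrow> g s = (s - 1) ^ m * L s" "1 \<le> Re s" "Re s \<le> 1 + 2 * w"
    using near[OF that] .
  define S where "S = H + real d * \<bar>Im s\<bar>"
  have S: "H \<le> S" by (simp add: S_def)
  show "norm (L s) \<le> exp ((5 / 8 * K + 401) * (H + real d * \<bar>Im s\<bar>))" if s: "Re s \<ge> 1 + w"
  proof (cases "Re s \<ge> 1 + 2 * w")
    case True
    have "norm (L s) \<le> exp (K / 2 * S + 2 * H)" using far(1)[OF True] by (simp add: S_def)
    also have "K / 2 * S + 2 * H \<le> (5 / 8 * K + 401) * S"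
    proof -
      have "0 \<le> K * S" using K S H1 by (intro mult_nonneg_nonneg) auto
      moreover have "(5 / 8 * K + 401) * S = 5 / 8 * (K * S) + 401 * S" "K / 2 * S = (K * S) / 2"
        by (simp_all add: algebra_simps)
      ultimately show ?thesis using S H1 by linarith
    qed
    finally show ?thesis by (simp add: S_def)
  next
    case False
    obtain g where g: "g holomorphic_on UNIV" "\<And>s. s \<noteq> 1 \<Longrightarrow> g s = (s - 1) ^ m * L s"
      using continuation_pole_removed[OF cont(1)] by metis
    have gs: "norm (g s) \<le> norm (s + 2) ^ m * exp ((5 / 8 * K + 400) * S)"
      using near[OF g, of s] False s wpos by (simp add: S_def)
    have sw: "norm (s - 1) \<ge> w"
      using s complex_Re_le_cmod[of "s - 1"] by simp
    \<comment> \<open>The distance from s to 1 is at least w, and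
      \<open>3 = (\<Delta> / 56) * w\<close>. Dividing by \<open>(s - 1) ^ m\<close> thus costs
      \<open>m * \<Delta> \<le> d * \<Delta> \<le> H\<close> in the exponent, which turns 400 into
      401.\<close>
    have "norm (s + 2) \<le> exp \<Delta> * norm (s - 1)"
    proof -
      have "norm (s + 2) \<le> norm (s - 1) + 3"
        using norm_triangle_ineq[of "s - 1" 3] by (simp add: algebra_simps)
      also have "3 = (\<Delta> / 56) * w" using \<Delta> by (simp add: w)
      also have "norm (s - 1) + \<Delta> / 56 * w \<le> norm (s - 1) + \<Delta> / 56 * norm (s - 1)"
        using sw \<Delta> by (intro add_left_mono mult_left_mono) auto
      also have "\<dots> = (1 + \<Delta> / 56) * norm (s - 1)" by (simp add: algebra_simps)
      also have "\<dots> \<le> exp \<Delta> * norm (s - 1)"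
      proof (rule mult_right_mono)
        have "1 + \<Delta> / 56 \<le> 1 + \<Delta>" using \<Delta> by simp
        also have "\<dots> \<le> exp \<Delta>" by (rule exp_ge_add_one_self)
        finally show "1 + \<Delta> / 56 \<le> exp \<Delta>" .
      qed auto
      finally show ?thesis .
    qed
    then have pow: "norm (s + 2) ^ m \<le> exp (real m * \<Delta>) * norm (s - 1) ^ m"
      using power_mono[of "norm (s + 2)" "exp \<Delta> * norm (s - 1)" m]
      by (simp add: power_mult_distrib exp_of_nat_mult)
    have "s \<noteq> 1" using s wpos by auto
    then have "norm (g s) = norm (s - 1) ^ m * norm (L s)"
      by (simp add: g(2) norm_mult norm_power)
    then have "norm (s - 1) ^ m * norm (L s) \<le> norm (s + 2) ^ m * exp ((5 / 8 * K + 400) * S)"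
      using gs by simp
    also have "\<dots> \<le> exp (real m * \<Delta>) * norm (s - 1) ^ m * exp ((5 / 8 * K + 400) * S)"
      by (intro mult_right_mono pow) auto
    finally have "norm (s - 1) ^ m * norm (L s) \<le>
        exp (real m * \<Delta>) * norm (s - 1) ^ m * exp ((5 / 8 * K + 400) * S)" .
    then have "norm (s - 1) ^ m * norm (L s) \<le> norm (s - 1) ^ m * (exp (real m * \<Delta>) * exp ((5 / 8 * K + 400) * S))"
      by (simp add: mult_ac)
    moreover have "norm (s - 1) ^ m > 0" using sw wpos by (intro zero_less_power) linarith
    ultimately have "norm (L s) \<le> exp (real m * \<Delta>) * exp ((5 / 8 * K + 400) * S)"
      by (simp only: mult_le_cancel_left_pos)
    also have "\<dots> \<le> exp ((5 / 8 * K + 401) * S)"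
    proof -
      have "real m * \<Delta> \<le> real d * \<Delta>" using m \<Delta> by (intro mult_right_mono) auto
      then have "real m * \<Delta> \<le> S" using H\<Delta> S by linarith
      then show ?thesis by (simp add: algebra_simps flip: exp_add)
    qed
    finally show ?thesis by (simp add: S_def)
  qed
qed

text \<open>Iterate \<open>bootstrap_step\<close> from the bounds Z and Z' of absolute convergence.
  The map taking k to \<open>5 / 8 * k + 401\<close> is a contraction with fixed point below 1070,
  so the starting values, which depend on the functions, disappear in the limit.\<close>

lemma half_plane_bound:
  fixes d m m' :: nat and w H \<Delta> :: real
  assumes pair: "dual_pair d Q \<beta> \<omega> A m L A' m' L'" and d: "d \<ge> 1"
    and \<Delta>: "\<Delta> \<ge> 1344" "real d \<le> exp (2 * \<Delta>)" and w: "w = 168 / \<Delta>"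
    and H: "H \<ge> real d * \<Delta> * exp \<Delta>" "H \<ge> ln (conductor d Q \<beta>) / \<Delta>" "H \<ge> 1"
    and s: "Re s \<ge> 1 + w"
  shows "norm (L s) \<le> exp (1070 * (H + real d * \<bar>Im s\<bar>))"
    "norm (L' s) \<le> exp (1070 * (H + real d * \<bar>Im s\<bar>))"
proof -
  have pair': "dual_pair d Q (\<lambda>i. cnj (\<beta> i)) (inverse \<omega>) A' m' L' A m L"
    using dual_pair_sym[OF pair] .
  have H': "H \<ge> ln (conductor d Q (\<lambda>i. cnj (\<beta> i))) / \<Delta>"
    using H(2) by (simp add: conductor_cnj)
  have w1: "1 + w > 1" using \<Delta> by (simp add: w)
  obtain Z where Z: "Z \<ge> 0" "\<And>s. Re s \<ge> 1 + w \<Longrightarrow> norm (L s) \<le> Z"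
    using L_bounded_right[of d A L "1 + w"] pair w1 unfolding dual_pair_def by metis
  obtain Z' where Z': "Z' \<ge> 0" "\<And>s. Re s \<ge> 1 + w \<Longrightarrow> norm (L' s) \<le> Z'"
    using L_bounded_right[of d A' L' "1 + w"] pair w1 unfolding dual_pair_def by metis
  define S where "S = (\<lambda>s. H + real d * \<bar>Im s\<bar>)"
  have S: "S s \<ge> 1" for s using H(3) by (simp add: S_def add_increasing2)
  define k where "k = (\<lambda>n::nat. (5 / 8) ^ n * (Z + Z') + 1070)"
  have k0: "k n \<ge> 0" for n using Z Z' by (simp add: k_def)
  have iter: "norm (L s) \<le> exp (k n * S s) \<and> norm (L' s) \<le> exp (k n * S s)" if "Re s \<ge> 1 + w" for n s
    using that
  proof (induction n arbitrary: s)
    case 0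
    have "Z + Z' \<le> k 0 * 1" by (simp add: k_def)
    also have "\<dots> \<le> k 0 * S s" using S k0 by (intro mult_left_mono) auto
    also have "\<dots> \<le> exp (k 0 * S s)" using exp_ge_add_one_self[of "k 0 * S s"] by linarith
    finally show ?case using Z(1) Z'(1) Z(2)[OF 0] Z'(2)[OF 0] by linarith
  next
    case (Suc n)
    have le: "exp ((5 / 8 * k n + 401) * S s) \<le> exp (k (Suc n) * S s)"
    proof -
      have "5 / 8 * k n + 401 \<le> k (Suc n)" by (simp add: k_def)
      then show ?thesis using S[of s] by (simp add: mult_right_mono)
    qed
    have IH: "norm (L s) \<le> exp (k n * (H + real d * \<bar>Im s\<bar>))" 
        "norm (L' s) \<le> exp (k n * (H + real d * \<bar>Im s\<bar>))" if "Re s \<ge> 1 + w" for s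
      using Suc.IH[OF that] by (simp_all add: S_def)
    show ?case
      using bootstrap_step(2)[OF pair d \<Delta> w k0 H(1,2) IH Suc.prems]
        bootstrap_step(2)[OF pair' d \<Delta> w k0 H(1) H' IH(2,1) Suc.prems] le
      unfolding S_def by (intro conjI) linarith+
  qed
  have "(\<lambda>n. exp (k n * S s)) \<longlonglongrightarrow> exp ((0 * (Z + Z') + 1070) * S s)"
    unfolding k_def by (intro tendsto_intros LIMSEQ_power_zero) auto
  then have lim: "(\<lambda>n. exp (k n * S s)) \<longlonglongrightarrow> exp (1070 * S s)" by simp
  show "norm (L s) \<le> exp (1070 * (H + real d * \<bar>Im s\<bar>))"
    using LIMSEQ_le_const[OF lim, of "norm (L s)"] iter[OF s] by (auto simp: S_def)
  show "norm (L' s) \<le> exp (1070 * (H + real d * \<bar>Im s\<bar>))"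
    using LIMSEQ_le_const[OF lim, of "norm (L' s)"] iter[OF s] by (auto simp: S_def)
qed

section \<open>The bound up to the edge and the choice of parameters\<close>

lemma edge_bound_exp:
  fixes d m :: nat and H \<Delta> :: real
  assumes L: "L_function d A m Q \<beta> L" and d: "d \<ge> 1"
    and \<Delta>: "\<Delta> \<ge> 1344" "real d \<le> exp (2 * \<Delta>)"
    and H: "H \<ge> real d * \<Delta> * exp \<Delta>" "H \<ge> ln (conductor d Q \<beta>) / \<Delta>"
  shows "edge_bound m L (exp (1071 * H))"
proof -
  obtain \<omega> A' m' L' where pair: "dual_pair d Q \<beta> \<omega> A m L A' m' L'"
    using L L_function_iff_dual_pair by blast
  define w where "w = 168 / \<Delta>"
  have wpos: "0 < w" "w \<le> 1/8" using \<Delta> by (auto simp: w_def field_simps)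
  have cont: "continuation_condition m L" "continuation_condition m' L'" using pair by (auto simp: dual_pair_def)
  have m: "m \<le> d"
    using pair by (intro pole_order_le_degree[OF cont]) (auto simp: dual_pair_def)
  obtain g where g: "g holomorphic_on UNIV" "\<And>s. s \<noteq> 1 \<Longrightarrow> g s = (s - 1) ^ m * L s"
    using continuation_pole_removed[OF cont(1)] by metis
  have "real d * 1344 * 1 \<le> real d * \<Delta> * exp \<Delta>" using \<Delta> by (intro mult_mono) auto
  then have Hd: "1344 * real d \<le> H" using H(1) by simp
  moreover have "real d \<ge> 1" using d by simp
  ultimately have H1: "H \<ge> 1" by linarith
  \<comment> \<open>4 dominates \<open>\<sigma> + 2\<close> on the short segment next to 1 and
    \<open>\<sigma> - 1\<close> up to 3.\<close>
  have pow: "4 ^ m \<le> exp H"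
  proof -
    have "(4::real) ^ m \<le> exp 4 ^ m"
      by (intro power_mono order.trans[OF _ exp_ge_add_one_self]) auto
    also have "\<dots> = exp (4 * real m)" by (simp add: mult.commute flip: exp_of_nat_mult)
    also have "4 * real m \<le> H" using m Hd H1 by linarith
    finally show ?thesis by simp
  qed
  note bound = half_plane_bound[OF pair d \<Delta> w_def H H1]
  \<comment> \<open>One more step with \<open>K = 1070\<close> reaches the edge. Since g has the
    pole removed, the endpoint 1 is an ordinary point.\<close>
  have near: "norm (g (of_real \<sigma>)) \<le> exp (1071 * H)" if \<sigma>: "1 \<le> \<sigma>" "\<sigma> \<le> 1 + 2 * w" for \<sigma> :: real
  proof -
    have "norm (g (of_real \<sigma>)) \<le> norm (of_real \<sigma> + 2 :: complex) ^ m * exp ((5 / 8 * 1070 + 400) * (H + real d * \<bar>Im (of_real \<sigma>)\<bar>))"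
      by (rule bootstrap_step(1)[OF pair d \<Delta> w_def _ H bound g]) (use \<sigma> in auto)
    also have "norm (of_real \<sigma> + 2 :: complex) = \<sigma> + 2"
    proof -
      have "(of_real \<sigma> + 2 :: complex) = of_real (\<sigma> + 2)" by simp
      then show ?thesis using \<sigma> by (simp only: norm_of_real)
    qed
    also have "(\<sigma> + 2) ^ m * exp ((5 / 8 * 1070 + 400) * (H + real d * \<bar>Im (of_real \<sigma>)\<bar>)) \<le> exp H * exp (1070 * H)"
      using \<sigma> wpos H1 by (intro mult_mono order.trans[OF power_mono pow]) auto
    finally show ?thesis by (simp flip: exp_add)
  qed
  have g_eq: "g (of_real \<sigma>) = of_real (\<sigma> - 1) ^ m * L (of_real \<sigma>)" if "\<sigma> > 1" for \<sigma> :: real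
    using g(2)[of "of_real \<sigma>"] that by (simp add: of_real_eq_1_iff)
  show ?thesis
    unfolding edge_bound_def
  proof (intro conjI allI impI)
    fix \<sigma> :: real assume \<sigma>: "1 < \<sigma> \<and> \<sigma> \<le> 3"
    show "norm (of_real (\<sigma> - 1) ^ m * L (of_real \<sigma>)) \<le> exp (1071 * H)"
    proof (cases "\<sigma> \<le> 1 + 2 * w")
      case True
      then show ?thesis using near[of \<sigma>] \<sigma> g_eq[of \<sigma>] by simp
    next
      case False
      have "norm (L (of_real \<sigma>)) \<le> exp (1070 * H)"
        using bound(1)[of "of_real \<sigma>"] False wpos by simp
      moreover have "norm (of_real (\<sigma> - 1) ^ m :: complex) \<le> exp H"
        unfolding norm_power norm_of_real using \<sigma> by (intro order.trans[OF power_mono pow]) auto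
      ultimately have "norm (of_real (\<sigma> - 1) ^ m * L (of_real \<sigma>)) \<le> exp H * exp (1070 * H)"
        unfolding norm_mult by (intro mult_mono) auto
      then show ?thesis by (simp flip: exp_add)
    qed
  next
    have "isCont g (of_real 1)"
      using holomorphic_on_imp_continuous_on[OF g(1)] by (simp add: continuous_on_eq_continuous_at)
    then have "((\<lambda>\<sigma>::real. g (of_real \<sigma>)) \<longlongrightarrow> g (of_real 1)) (at_right 1)"
      by (rule isCont_tendsto_compose) (intro tendsto_intros)
    moreover have "eventually (\<lambda>\<sigma>. g (of_real \<sigma>) = of_real (\<sigma> - 1) ^ m * L (of_real \<sigma>)) (at_right 1)"
      using eventually_at_right_less[of 1] by eventually_elim (rule g_eq)
    ultimately have "((\<lambda>\<sigma>::real. of_real (\<sigma> - 1) ^ m * L (of_real \<sigma>)) \<longlongrightarrow> g (of_real 1)) (at_right 1)"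
      by (rule Lim_transform_eventually)
    moreover have "norm (g (of_real 1)) \<le> exp (1071 * H)" using near[of 1] wpos by simp
    ultimately show "\<exists>l. ((\<lambda>\<sigma>::real. of_real (\<sigma> - 1) ^ m * L (of_real \<sigma>)) \<longlongrightarrow> l) (at_right 1) \<and> norm l \<le> exp (1071 * H)"
      by blast
  qed
qed

text \<open>\<open>exp \<Delta>\<close> has order \<open>sqrt l\<close>, so
  \<open>d * \<Delta> * exp \<Delta>\<close> is O(\<open>d * l / ln l\<close>), while
  \<open>\<Delta> \<ge> ln l / 2\<close> makes \<open>l / \<Delta>\<close> at most
  \<open>2 * l / ln l\<close>.\<close>

lemma L_function_edge_bound:
  assumes L: "L_function d A m Q \<beta> L" and d: "d \<ge> 1"
  shows "edge_bound m L (exp (1071 * (5384 * exp 1344 + 2) * real d *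
           (ln (conductor d Q \<beta>) / ln (ln (conductor d Q \<beta>)))))"
proof -
  define l where "l = ln (conductor d Q \<beta>)"
  \<comment> \<open>\<open>1344 = 8 * 168\<close> keeps \<open>w = 168 / \<Delta>\<close> at most
    1/8.\<close>
  define \<Delta> where "\<Delta> = 1344 + ln l / 2"
  define X where "X = real d * (l / ln l)"
  have d1: "real d \<ge> 1" using d by simp
  have ln3: "ln 3 > (1::real)"
    using exp_less_cancel_iff[of 1 "ln 3"] e_less_272 by simp
  \<comment> \<open>From \<open>ln 3 > 1\<close> this yields \<open>d \<le> l\<close> and
    \<open>l > 1\<close>, so that \<open>ln l\<close> is positive and
    \<open>d \<le> exp (2 * \<Delta>)\<close>.\<close>
  have "ln (3 ^ d) \<le> l"
    unfolding l_def using conductor_bounds(1)[of d Q \<beta>]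
    by (intro ln_mono) (auto intro: less_le_trans[OF _ conductor_bounds(1)])
  then have l: "real d * ln 3 \<le> l" by (simp add: ln_realpow)
  have "real d * 1 \<le> real d * ln 3" using ln3 by (intro mult_left_mono) auto
  then have dl: "real d \<le> l" using l by simp
  have "1 * ln 3 \<le> real d * ln 3" using ln3 d1 by (intro mult_right_mono) auto
  then have l1: "l > 1" using l ln3 by linarith
  then have lnl: "ln l > 0" by simp
  have "exp (2 * \<Delta>) = exp 2688 * l"
    using l1 by (simp add: \<Delta>_def exp_add distrib_left)
  also have "\<dots> \<ge> 1 * l" using l1 by (intro mult_right_mono) auto
  finally have d\<Delta>: "real d \<le> exp (2 * \<Delta>)" using dl by simp
  have \<Delta>: "\<Delta> \<ge> 1344" using lnl by (simp add: \<Delta>_def)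
  have X: "X \<ge> 0" using l1 lnl by (simp add: X_def)
  have h1: "real d * \<Delta> * exp \<Delta> \<le> 5384 * exp 1344 * X"
  proof -
    \<comment> \<open>u is the fourth root of l. From \<open>ln l \<le> 4 * u\<close> and
      \<open>\<Delta> \<le> 1346 * u\<close> comes the constant
      \<open>5384 = 4 * 1346\<close>.\<close>
    define u where "u = exp (ln l / 4)"
    have u1: "u \<ge> 1" using lnl by (simp add: u_def)
    have lu: "l = (u * u) * (u * u)"
      using l1 by (simp add: u_def flip: exp_add)
    have "ln l / 4 \<le> u" using exp_ge_add_one_self[of "ln l / 4"] unfolding u_def by linarith
    then have lnu: "ln l \<le> 4 * u" by simp
    have e\<Delta>: "exp \<Delta> = exp 1344 * (u * u)"
      by (simp add: \<Delta>_def u_def exp_add flip: exp_add)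
    have "\<Delta> \<le> 1346 * u" using lnu u1 by (simp add: \<Delta>_def)
    then have "\<Delta> * ln l \<le> (1346 * u) * (4 * u)" using lnu lnl \<Delta> u1 by (intro mult_mono) auto
    then have "\<Delta> * ln l * (u * u) \<le> 5384 * (u * u) * (u * u)"
      using u1 by (intro mult_right_mono) auto
    then have "\<Delta> * (u * u) \<le> 5384 * (l / ln l)"
      using lnl lu by (simp add: field_simps)
    then have "(real d * exp 1344) * (\<Delta> * (u * u)) \<le> (real d * exp 1344) * (5384 * (l / ln l))"
      by (intro mult_left_mono) auto
    then show ?thesis by (simp add: e\<Delta> X_def mult_ac)
  qed
  have h2: "l / \<Delta> \<le> 2 * X"
  proof -
    have "l / \<Delta> \<le> l / (ln l / 2)"
      using l1 lnl \<Delta> by (intro divide_left_mono mult_pos_pos) (auto simp: \<Delta>_def add_pos_pos)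
    also have "\<dots> = 1 * (2 * (l / ln l))" by simp
    also have "\<dots> \<le> real d * (2 * (l / ln l))"
      using d1 l1 lnl by (intro mult_right_mono) auto
    finally show ?thesis by (simp add: X_def mult_ac)
  qed
  define H where "H = (5384 * exp 1344 + 2) * X"
  have "real d * \<Delta> * exp \<Delta> \<le> H" "ln (conductor d Q \<beta>) / \<Delta> \<le> H"
  proof -
    have "0 \<le> 5384 * exp 1344 * X" using X by (intro mult_nonneg_nonneg) auto
    moreover have "H = 5384 * exp 1344 * X + 2 * X" by (simp add: H_def distrib_right)
    ultimately show "real d * \<Delta> * exp \<Delta> \<le> H" "ln (conductor d Q \<beta>) / \<Delta> \<le> H"
      using h1 h2 X unfolding l_def by linarith+
  qed
  from edge_bound_exp[OF L d \<Delta> d\<Delta> this] show ?thesis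
    by (simp add: H_def X_def l_def mult_ac)
qed

theorem theorem1:
  shows "(\<forall>m. \<exists>C>0. \<exists>K>0. \<forall>d\<ge>1. \<forall>A Q \<beta> L. L_function d A m Q \<beta> L \<longrightarrow>
            edge_bound m L
              (K * exp (C * real d * (ln (conductor d Q \<beta>) / ln (ln (conductor d Q \<beta>))))))
       \<and> (\<exists>C>0. \<exists>K>0. \<forall>m. \<forall>d\<ge>1. \<forall>A Q \<beta> L. m \<le> d \<longrightarrow> L_function d A m Q \<beta> L \<longrightarrow>
            edge_bound m L
              (K * exp (C * real d * (ln (conductor d Q \<beta>) / ln (ln (conductor d Q \<beta>))))))"
proof -
  \<comment> \<open>C is absolute and K is 1, so a single bound yields both conjuncts.\<close>
  define C where "C = 1071 * (5384 * exp 1344 + 2 :: real)"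
  have main: "edge_bound m L
      (1 * exp (C * real d * (ln (conductor d Q \<beta>) / ln (ln (conductor d Q \<beta>)))))"
    if "d \<ge> 1" "L_function d A m Q \<beta> L" for d m A Q \<beta> L
    unfolding C_def mult_1 by (rule L_function_edge_bound[OF that(2,1)])
  have "\<exists>K>0. \<forall>m. \<forall>d\<ge>1. \<forall>A Q \<beta> L. L_function d A m Q \<beta> L \<longrightarrow>
      edge_bound m L
        (K * exp (C * real d * (ln (conductor d Q \<beta>) / ln (ln (conductor d Q \<beta>)))))"
    using main by (intro exI[of _ "1::real"] conjI) (simp, blast)
  moreover have "C > 0" by (simp add: C_def add_pos_pos)
  ultimately show ?thesis by blast
qed

end
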